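(* Let $(X,\|\cdot\|)$ be a separable infinite dimensional real Banach space and let $|||\cdot|||$ be the asymptotic norm on $X$ generated by $\|\cdot\|$. Then $X$ contains an isomorph of $c_0$ if there exists a weakly null basic array $(x_i^n)_{n,i\in\omega}\subseteq X$ generating, in $(X,|||\cdot|||)$, an asymptotic model $(e_i)_{i\in\omega}$ which is $1$-equivalent to the unit vector basis of $c_0$.
   Context: Asymptotic norm: for $c,x\in X$ put $\|x\|_c=\big\|c\|x\|+x\big\|+\big\|c\|x\|-x\big\|$. Let $C$ be a countable dense subset of $X$ and choose $p_c>0$ ($c\in C$) with $\sum_{c\in C}p_c(1+\|c\|)<\infty$. The asymptotic norm generated by $\|\cdot\|$ is the equivalent norm $|||x|||=\sum_{c\in C}p_c\|x\|_c$ on $X$; the $p_c$ are taken so that also $|||x|||\ge\|x\|$ for all $x$. Conventions: $\omega=\{0,1,2,\ldots\}$ and $n\in\omega$ is identified with $\{0,\ldots,n-1\}$. In the claim the array is a basic array, and generates its asymptotic model, with respect to the norm $|||\cdot|||$; in the following general definitions $\|\cdot\|$ denotes the norm of the space under consideration. A (finite or infinite) sequence of non-zero vectors $(z_i)$ is $K$-basic if $\|\sum_{i\in n}a_iz_i\|\le K\|\sum_{i\in m}a_iz_i\|$ for all $n<m$ (with $m$ at most the length) and all real scalars. A $K$-basic array is a family $(x_i^n)_{n,i\in\omega}$ such that every row $(x_i^n)_{i\in\omega}$ is a normalized $K$-basic sequence, and for all $m\in\omega$ and all $m\le i_0<\cdots<i_{m-1}$ the sequence $(x_{i_j}^j)_{j\in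 m}$ is $K$-basic; a basic array is a $K$-basic array for some $K<\infty$ (only entries with $i\ge n$ matter). It is weakly null if every row is weakly null. A basic array $(x_i^n)$ generates an asymptotic model if for some positive $\varepsilon_n\downarrow0$, for all $n$, all $(b_j)_{j\in n}\in[-1,1]^n$ and all $n\le i_0<\cdots<i_{n-1}$, $n\le\ell_0<\cdots<\ell_{n-1}$, $\big|\|\sum_{j\in n}b_jx_{i_j}^j\|-\|\sum_{j\in n}b_jx_{\ell_j}^j\|\big|<\varepsilon_n$. The asymptotic model generated is then the unit vector basis $(e_i)_{i\in\omega}$ of the completion of $c_{00}$ (finitely supported real sequences) under the norm $\|\sum_{j\in n}b_je_j\|=\lim_{i_0\to\infty}\cdots\lim_{i_{n-1}\to\infty}\|\sum_{j\in n}b_jx_{i_j}^j\|$. Basic sequences $(u_i)$, $(v_i)$ are $C$-equivalent if there are constants $A,B$ with $AB\le C$ and $A^{-1}\|\sum_{i\in n}a_iu_i\|\le\|\sum_{i\in n}a_iv_i\|\le B\|\sum_{i\in n}a_iu_i\|$ for all $n$ and all scalars. *)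

theory Defs
  imports "HOL-Analysis.Analysis"
begin

text \<open>A second norm on the carrier of a normed space is a function \<open>N\<close> of type \<open>'a \<Rightarrow> real\<close>.\<close>

subsection \<open>The asymptotic norm\<close>

definition norm_at :: "'a::real_normed_vector \<Rightarrow> 'a \<Rightarrow> real" where
  "norm_at c x = norm (norm x *\<^sub>R c + x) + norm (norm x *\<^sub>R c - x)"

text \<open>The construction depends on the choice of \<open>C\<close> and \<open>p\<close>; \<open>asymptotic_norm N\<close> says that
  \<open>N\<close> arises from some choice.\<close>

definition asymptotic_norm :: "('a::real_normed_vector \<Rightarrow> real) \<Rightarrow> bool" where
  "asymptotic_norm N \<longleftrightarrow>
    (\<exists>C p. countable C \<and> closure C = UNIV \<and> (\<forall>c\<in>C. 0 < p c) \<and>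
       (\<lambda>c. p c * (1 + norm c)) summable_on C \<and>
       N = (\<lambda>x. \<Sum>\<^sub>\<infinity>c\<in>C. p c * norm_at c x) \<and>
       (\<forall>x. norm x \<le> N x))"

subsection \<open>Basic arrays\<close>

text \<open>\<open>L\<close> is the length of the sequence; \<open>\<infinity>\<close> for infinite sequences.\<close>

definition basic_seq ::
    "('a::real_vector \<Rightarrow> real) \<Rightarrow> real \<Rightarrow> enat \<Rightarrow> (nat \<Rightarrow> 'a) \<Rightarrow> bool" where
  "basic_seq N K L z \<longleftrightarrow>
    (\<forall>i. enat i < L \<longrightarrow> z i \<noteq> 0) \<and>
    (\<forall>n m. \<forall>a :: nat \<Rightarrow> real. n < m \<and> enat m \<le> L \<longrightarrow>
       N (\<Sum>i<n. a i *\<^sub>R z i) \<le> K * N (\<Sum>i<m. a i *\<^sub>R z i))"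

text \<open>Indices \<open>m \<le> i 0 < \<dots> < i (m - 1)\<close>; values of \<open>i\<close> from \<open>m\<close> on are irrelevant.\<close>

definition admissible_indices :: "nat \<Rightarrow> (nat \<Rightarrow> nat) \<Rightarrow> bool" where
  "admissible_indices m i \<longleftrightarrow> strict_mono_on {..<m} i \<and> (\<forall>j<m. m \<le> i j)"

text \<open>In an array, \<open>x n i\<close> is the \<open>i\<close>-th entry of row \<open>n\<close>.\<close>

definition basic_array :: "('a::real_vector \<Rightarrow> real) \<Rightarrow> (nat \<Rightarrow> nat \<Rightarrow> 'a) \<Rightarrow> bool" where
  "basic_array N x \<longleftrightarrow>
    (\<exists>K. (\<forall>n. (\<forall>i. N (x n i) = 1) \<and> basic_seq N K \<infinity> (x n)) \<and>
         (\<forall>m i. admissible_indices m i \<longrightarrow> basic_seq N K (enat m) (\<lambda>j. x j (i j))))"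

definition weakly_null :: "(nat \<Rightarrow> 'a::real_normed_vector) \<Rightarrow> bool" where
  "weakly_null z \<longleftrightarrow> (\<forall>f :: 'a \<Rightarrow> real. bounded_linear f \<longrightarrow> (\<lambda>i. f (z i)) \<longlonglongrightarrow> 0)"

definition weakly_null_array :: "(nat \<Rightarrow> nat \<Rightarrow> 'a::real_normed_vector) \<Rightarrow> bool" where
  "weakly_null_array x \<longleftrightarrow> (\<forall>n. weakly_null (x n))"

subsection \<open>Asymptotic models\<close>

definition generates_asymptotic_model ::
    "('a::real_vector \<Rightarrow> real) \<Rightarrow> (nat \<Rightarrow> nat \<Rightarrow> 'a) \<Rightarrow> bool" where
  "generates_asymptotic_model N x \<longleftrightarrow>
    (\<exists>\<epsilon> :: nat \<Rightarrow> real. (\<forall>n. 0 < \<epsilon> n) \<and> decseq \<epsilon> \<and> \<epsilon> \<longlonglongrightarrow> 0 \<and>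
      (\<forall>n b i l. (\<forall>j<n. b j \<in> {-1..1}) \<and> admissible_indices n i \<and> admissible_indices n l \<longrightarrow>
         \<bar>N (\<Sum>j<n. b j *\<^sub>R x j (i j)) - N (\<Sum>j<n. b j *\<^sub>R x j (l j))\<bar> < \<epsilon> n))"

primrec iterated_eventually :: "nat \<Rightarrow> (nat list \<Rightarrow> bool) \<Rightarrow> bool" where
  "iterated_eventually 0 P \<longleftrightarrow> P []"
| "iterated_eventually (Suc n) P \<longleftrightarrow>
     (\<forall>\<^sub>F i in sequentially. iterated_eventually n (\<lambda>is. P (i # is)))"

text \<open>The iterated limit of \<open>f [i\<^sub>0, \<dots>, i\<^sub>n\<^sub>-\<^sub>1]\<close>, the limit in \<open>i\<^sub>0\<close> outermost.
  Generating an asymptotic model bounds the oscillation of the norms only as \<open>i\<^sub>0\<close> tends to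
  infinity, so for a fixed \<open>i\<^sub>0\<close> an inner limit may fail to exist. Hence the limit is taken along
  the iterated filter: \<open>f\<close> is near \<open>L\<close> for all large \<open>i\<^sub>0\<close>, for all large \<open>i\<^sub>1\<close>
  (depending on \<open>i\<^sub>0\<close>), and so on. The lemmas below show that this limit is unique and that it
  is the nested limit whenever the latter exists.\<close>

definition has_iterated_limit :: "nat \<Rightarrow> (nat list \<Rightarrow> real) \<Rightarrow> real \<Rightarrow> bool" where
  "has_iterated_limit n f L \<longleftrightarrow> (\<forall>\<epsilon>>0. iterated_eventually n (\<lambda>is. \<bar>f is - L\<bar> < \<epsilon>))"

lemma iterated_eventually_mono:
  "\<lbrakk>iterated_eventually n P; \<And>is. P is \<Longrightarrow> Q is\<rbrakk> \<Longrightarrow> iterated_eventually n Q"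
proof (induction n arbitrary: P Q)
  case (Suc n)
  from Suc.prems(1) have "\<forall>\<^sub>F i in sequentially. iterated_eventually n (\<lambda>is. P (i # is))"
    by simp
  then have "\<forall>\<^sub>F i in sequentially. iterated_eventually n (\<lambda>is. Q (i # is))"
    by (rule eventually_mono) (rule Suc.IH, assumption, rule Suc.prems(2))
  then show ?case by simp
qed simp

lemma iterated_eventually_conj:
  "\<lbrakk>iterated_eventually n P; iterated_eventually n Q\<rbrakk>
    \<Longrightarrow> iterated_eventually n (\<lambda>is. P is \<and> Q is)"
  by (induction n arbitrary: P Q) (auto elim: eventually_elim2)

lemma iterated_eventually_const: "iterated_eventually n (\<lambda>_. P) \<longleftrightarrow> P"
  by (induction n) auto

lemma has_iterated_limit_0: "has_iterated_limit 0 f L \<longleftrightarrow> f [] = L"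
proof
  assume "has_iterated_limit 0 f L"
  then have "\<forall>\<epsilon>>0. \<bar>f [] - L\<bar> < \<epsilon>" by (simp add: has_iterated_limit_def)
  then have "\<not> \<bar>f [] - L\<bar> > 0" by blast
  then show "f [] = L" by simp
qed (simp add: has_iterated_limit_def)

lemma has_iterated_limit_Suc:
  assumes inner: "\<forall>\<^sub>F i in sequentially. has_iterated_limit n (\<lambda>is. f (i # is)) (g i)"
    and outer: "g \<longlonglongrightarrow> L"
  shows "has_iterated_limit (Suc n) f L"
  unfolding has_iterated_limit_def
proof (intro allI impI)
  fix \<epsilon> :: real assume "\<epsilon> > 0"
  then have "\<forall>\<^sub>F i in sequentially. \<bar>g i - L\<bar> < \<epsilon> / 2"
    using tendstoD[OF outer, of "\<epsilon> / 2"] by (simp add: dist_real_def)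
  with inner
  have "\<forall>\<^sub>F i in sequentially. iterated_eventually n (\<lambda>is. \<bar>f (i # is) - L\<bar> < \<epsilon>)"
  proof eventually_elim
    case (elim i)
    then have "iterated_eventually n (\<lambda>is. \<bar>f (i # is) - g i\<bar> < \<epsilon> / 2)"
      using \<open>\<epsilon> > 0\<close> unfolding has_iterated_limit_def by (metis half_gt_zero)
    then show ?case
      by (rule iterated_eventually_mono) (use elim in linarith)
  qed
  then show "iterated_eventually (Suc n) (\<lambda>is. \<bar>f is - L\<bar> < \<epsilon>)" by simp
qed

lemma has_iterated_limit_unique:
  assumes "has_iterated_limit n f L" "has_iterated_limit n f M"
  shows "L = M"
proof (rule ccontr)
  assume "L \<noteq> M"
  define \<epsilon> where "\<epsilon> = \<bar>L - M\<bar> / 2"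
  have "\<epsilon> > 0" using \<open>L \<noteq> M\<close> by (simp add: \<epsilon>_def)
  then have "iterated_eventually n (\<lambda>is. \<bar>f is - L\<bar> < \<epsilon> \<and> \<bar>f is - M\<bar> < \<epsilon>)"
    using assms by (intro iterated_eventually_conj) (auto simp: has_iterated_limit_def)
  then have "iterated_eventually n (\<lambda>_. False)"
    by (rule iterated_eventually_mono) (auto simp: \<epsilon>_def abs_if split: if_splits)
  then show False by (simp add: iterated_eventually_const)
qed

text \<open>The completion of \<open>c\<^sub>0\<^sub>0\<close> under the norm of the model is realised, up to isometry, as the
  closed linear span of \<open>range e\<close> in a Banach space, with \<open>e j\<close> the \<open>j\<close>-th unit vector.\<close>

definition asymptotic_model ::
    "('a::real_vector \<Rightarrow> real) \<Rightarrow> (nat \<Rightarrow> nat \<Rightarrow> 'a) \<Rightarrow> (nat \<Rightarrow> 'e::banach) \<Rightarrow> bool" where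
  "asymptotic_model N x e \<longleftrightarrow>
    generates_asymptotic_model N x \<and>
    (\<forall>n. \<forall>b :: nat \<Rightarrow> real.
       has_iterated_limit n (\<lambda>is. N (\<Sum>j<n. b j *\<^sub>R x j (is ! j))) (norm (\<Sum>j<n. b j *\<^sub>R e j)))"

subsection \<open>Equivalence of sequences and the space \<open>c\<^sub>0\<close>\<close>

definition equivalent_seqs ::
    "real \<Rightarrow> (nat \<Rightarrow> 'u::real_normed_vector) \<Rightarrow> (nat \<Rightarrow> 'v::real_normed_vector) \<Rightarrow> bool" where
  "equivalent_seqs C u v \<longleftrightarrow>
    (\<exists>A B. 0 < A \<and> 0 < B \<and> A * B \<le> C \<and>
      (\<forall>n. \<forall>a :: nat \<Rightarrow> real.
         inverse A * norm (\<Sum>i<n. a i *\<^sub>R u i) \<le> norm (\<Sum>i<n. a i *\<^sub>R v i) \<and>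
         norm (\<Sum>i<n. a i *\<^sub>R v i) \<le> B * norm (\<Sum>i<n. a i *\<^sub>R u i)))"

text \<open>As \<open>nat\<close> is discrete, \<open>nat \<Rightarrow>\<^sub>C real\<close> is the space of all bounded sequences with the
  supremum norm.\<close>

definition c0 :: "(nat \<Rightarrow>\<^sub>C real) set" where
  "c0 = {f. apply_bcontfun f \<longlonglongrightarrow> 0}"

definition c0_unit :: "nat \<Rightarrow> (nat \<Rightarrow>\<^sub>C real)" where
  "c0_unit i = Bcontfun (\<lambda>j. if j = i then 1 else 0)"

lemma apply_c0_unit: "apply_bcontfun (c0_unit i) j = (if j = i then 1 else 0)"
proof -
  have "(\<lambda>j. if j = i then 1 else 0 :: real) \<in> bcontfun"
    by (rule bcontfun_normI[where b = 1]) auto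
  then show ?thesis by (simp add: c0_unit_def Bcontfun_inverse)
qed

text \<open>An isomorph of \<open>Y\<close> is the image of \<open>Y\<close> under a linear homeomorphic embedding. \<open>T\<close> is
  only constrained on \<open>Y\<close>.\<close>

definition contains_isomorph ::
    "'a::real_normed_vector itself \<Rightarrow> 'y::real_normed_vector set \<Rightarrow> bool" where
  "contains_isomorph _ Y \<longleftrightarrow>
    (\<exists>T :: 'y \<Rightarrow> 'a.
      (\<forall>f\<in>Y. \<forall>g\<in>Y. T (f + g) = T f + T g) \<and>
      (\<forall>r. \<forall>f\<in>Y. T (r *\<^sub>R f) = r *\<^sub>R T f) \<and>
      (\<exists>A>0. \<exists>B>0. \<forall>f\<in>Y. A * norm f \<le> norm (T f) \<and> norm (T f) \<le> B * norm f))"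

end

theory Submission imports Defs begin

text \<open>Termwise convexity of the series defining \<open>N\<close> turns \<open>N (x r m \<plusminus> x s n) \<rightarrow> 1\<close> into
  statements about each \<open>norm_at c\<close>. They show that \<open>norm (x r m) \<rightarrow> L > 0\<close> and
  that \<open>\<phi> y = lim\<^sub>m (norm (y + x r m) + norm (y - x r m))\<close> exists and does not
  depend on the row \<open>r\<close>, and moreover that \<open>\<phi> (y + z) + \<phi> (y - z)\<close> is at most about
  \<open>2 * \<phi> y\<close> for \<open>z\<close> far out in a row. As signed sums over many rows stay bounded by \<open>2\<close>,
  for most rows even \<open>\<phi> (y + z)\<close> and \<open>\<phi> (y - z)\<close> separately are at most about \<open>\<phi> y\<close>. Starting
  from \<open>\<phi> 0 = 2 * L\<close> one picks \<open>z\<^sub>0, z\<^sub>1, \<dots>\<close> of norm almost \<open>L\<close> all of whose signed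
  sums \<open>y\<close> satisfy \<open>2 * norm y \<le> \<phi> y \<le> 2 * L + 2 * \<epsilon>\<close>; such a sequence spans \<open>c\<^sub>0\<close>.\<close>

subsection \<open>The norms \<open>norm_at c\<close>\<close>

lemma norm_at_0: "norm_at 0 x = 2 * norm x"
  by (simp add: norm_at_def)

lemma norm_at_minus: "norm_at c (- x) = norm_at c x"
  by (simp add: norm_at_def)

lemma norm_at_scaleR_2: "norm_at c (2 *\<^sub>R x) = 2 * norm_at c x"
proof -
  have "norm (2 *\<^sub>R x) *\<^sub>R c + 2 *\<^sub>R x = 2 *\<^sub>R (norm x *\<^sub>R c + x)"
    "norm (2 *\<^sub>R x) *\<^sub>R c - 2 *\<^sub>R x = 2 *\<^sub>R (norm x *\<^sub>R c - x)"
    by (simp_all add: algebra_simps)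
  then show ?thesis
    unfolding norm_at_def by (simp only: norm_scaleR distrib_left abs_numeral)
qed

lemma norm_at_le: "norm_at c x \<le> 2 * norm x * (1 + norm c)"
  using norm_triangle_ineq[of "norm x *\<^sub>R c" x] norm_triangle_ineq4[of "norm x *\<^sub>R c" x]
  by (simp add: norm_at_def algebra_simps)

text \<open>As a function of \<open>t\<close> the left side is convex and even, hence nondecreasing
  in \<open>\<bar>t\<bar>\<close>. This handles the factor \<open>norm x\<close> inside
  \<open>norm_at\<close>, which is not linear in \<open>x\<close>.\<close>

lemma norm_pair_mono:
  fixes c w :: "'a::real_normed_vector"
  assumes "\<bar>t\<bar> \<le> s"
  shows "norm (t *\<^sub>R c + w) + norm (t *\<^sub>R c - w) \<le> norm (s *\<^sub>R c + w) + norm (s *\<^sub>R c - w)"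
proof (cases "s = 0")
  case False
  with assms have "s > 0" by linarith
  \<comment> \<open>The weight that makes \<open>t *\<^sub>R c\<close> the convex combination of
    \<open>s *\<^sub>R c\<close> and \<open>- (s *\<^sub>R c)\<close>.\<close>
  define l where "l = (1 + t / s) / 2"
  have l: "0 \<le> l" "l \<le> 1"
    using assms \<open>s > 0\<close> by (auto simp: l_def field_simps abs_le_iff)
  have t: "t = (2 * l - 1) * s"
    using \<open>s > 0\<close> by (simp add: l_def field_simps)
  have "t *\<^sub>R c + w = l *\<^sub>R (s *\<^sub>R c + w) - (1 - l) *\<^sub>R (s *\<^sub>R c - w)"
    "t *\<^sub>R c - w = l *\<^sub>R (s *\<^sub>R c - w) - (1 - l) *\<^sub>R (s *\<^sub>R c + w)"
    by (simp_all add: t algebra_simps flip: scaleR_add_left)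
  then have "norm (t *\<^sub>R c + w) \<le> l * norm (s *\<^sub>R c + w) + (1 - l) * norm (s *\<^sub>R c - w)"
    "norm (t *\<^sub>R c - w) \<le> l * norm (s *\<^sub>R c - w) + (1 - l) * norm (s *\<^sub>R c + w)"
    using l by (metis norm_triangle_ineq4 norm_scaleR abs_of_nonneg diff_ge_0_iff_ge)+
  then show ?thesis by (simp add: algebra_simps)
qed (use assms in simp)

text \<open>The factor \<open>norm (u + v)\<close> may be enlarged to \<open>norm u + norm v\<close>
  by \<open>norm_pair_mono\<close>; after that both vectors split into a \<open>u\<close>-part and a
  \<open>v\<close>-part.\<close>

lemma norm_at_triangle: "norm_at c (u + v) \<le> norm_at c u + norm_at c v"
proof -
  define s where "s = norm u + norm v"
  have "norm_at c (u + v) \<le> norm (s *\<^sub>R c + (u + v)) + norm (s *\<^sub>R c - (u + v))"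
    unfolding norm_at_def by (rule norm_pair_mono) (simp add: s_def norm_triangle_ineq)
  also have "s *\<^sub>R c + (u + v) = (norm u *\<^sub>R c + u) + (norm v *\<^sub>R c + v)"
    by (simp add: s_def algebra_simps)
  also have "s *\<^sub>R c - (u + v) = (norm u *\<^sub>R c - u) + (norm v *\<^sub>R c - v)"
    by (simp add: s_def algebra_simps)
  also have "norm ((norm u *\<^sub>R c + u) + (norm v *\<^sub>R c + v)) +
      norm ((norm u *\<^sub>R c - u) + (norm v *\<^sub>R c - v)) \<le> norm_at c u + norm_at c v"
    unfolding norm_at_def by (smt (verit) norm_triangle_ineq)
  finally show ?thesis .
qed

lemma norm_at_midpoint: "2 * norm_at c u \<le> norm_at c (u + v) + norm_at c (u - v)"
  using norm_at_triangle[of c "u + v" "u - v"] norm_at_scaleR_2[of c u]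
  by (simp add: scaleR_2)

text \<open>The reverse triangle inequality, in a form with two uses: \<open>s = norm x\<close>
  compares \<open>norm_at c\<close> with \<open>norm_at d\<close>, while \<open>d = c\<close> with
  \<open>s\<close> a limit of norms frees the factor from its dependence on
  \<open>x\<close>.\<close>

lemma norm_at_diff_scaled:
  "\<bar>norm_at c x - (norm (s *\<^sub>R d + x) + norm (s *\<^sub>R d - x))\<bar> \<le> 2 * norm (norm x *\<^sub>R c - s *\<^sub>R d)"
proof -
  have "\<bar>norm (norm x *\<^sub>R c + x) - norm (s *\<^sub>R d + x)\<bar> \<le> norm (norm x *\<^sub>R c - s *\<^sub>R d)"
    using norm_triangle_ineq3[of "norm x *\<^sub>R c + x" "s *\<^sub>R d + x"] by simp
  moreover have "\<bar>norm (norm x *\<^sub>R c - x) - norm (s *\<^sub>R d - x)\<bar> \<le> norm (norm x *\<^sub>R c - s *\<^sub>R d)"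
    using norm_triangle_ineq3[of "norm x *\<^sub>R c - x" "s *\<^sub>R d - x"] by simp
  ultimately show ?thesis unfolding norm_at_def by linarith
qed

lemma norm_at_Lipschitz: "\<bar>norm_at c x - norm_at d x\<bar> \<le> 2 * norm x * norm (c - d)"
  using norm_at_diff_scaled[of c x "norm x" d] norm_at_def[of d x]
  by (simp flip: scaleR_diff_right)

section \<open>The series defining \<open>N\<close>\<close>

lemma asymptotic_norm_summable:
  assumes "(\<lambda>c. p c * (1 + norm c)) summable_on C" "\<And>c. c \<in> C \<Longrightarrow> 0 < p c"
  shows "(\<lambda>c. p c * norm_at c x) summable_on C"
proof (rule summable_on_comparison_test)
  show "(\<lambda>c. 2 * norm x * (p c * (1 + norm c))) summable_on C"
    by (rule summable_on_cmult_right[OF assms(1)])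
next
  fix c assume "c \<in> C"
  then have "0 \<le> p c" using assms(2) less_imp_le by blast
  then show "p c * norm_at c x \<le> 2 * norm x * (p c * (1 + norm c))"
    using mult_left_mono[OF norm_at_le[of c x], of "p c"] by (simp add: ac_simps)
  show "0 \<le> p c * norm_at c x"
    using \<open>0 \<le> p c\<close> by (simp add: norm_at_def)
qed

text \<open>The upper half of the equivalence of \<open>N\<close> with the norm. It keeps vectors
  with \<open>N x = 1\<close> away from 0, which later yields \<open>L > 0\<close>.\<close>

lemma asymptotic_norm_bounded:
  fixes N :: "'a::real_normed_vector \<Rightarrow> real"
  assumes "asymptotic_norm N"
  obtains D where "D > 0" "\<And>x. N x \<le> D * norm x"
proof -
  obtain C p where p: "\<And>c. c \<in> C \<Longrightarrow> 0 < p c"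
    and sm: "(\<lambda>c. p c * (1 + norm c)) summable_on C"
    and N: "N = (\<lambda>x. \<Sum>\<^sub>\<infinity>c\<in>C. p c * norm_at c x)"
    using assms unfolding asymptotic_norm_def by blast
  define D where "D = (\<Sum>\<^sub>\<infinity>c\<in>C. p c * (1 + norm c))"
  have "D \<ge> 0" unfolding D_def
    by (rule infsum_nonneg) (use p in \<open>auto intro!: mult_nonneg_nonneg simp: less_imp_le\<close>)
  \<comment> \<open>The summand 1 makes the constant positive knowing only
    \<open>D \<ge> 0\<close>.\<close>
  have "N x \<le> (2 * D + 1) * norm x" for x
  proof -
    have "N x \<le> (\<Sum>\<^sub>\<infinity>c\<in>C. 2 * norm x * (p c * (1 + norm c)))"
      unfolding N
    proof (rule infsum_mono[OF asymptotic_norm_summable[OF sm p]])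
      show "(\<lambda>c. 2 * norm x * (p c * (1 + norm c))) summable_on C"
        by (rule summable_on_cmult_right[OF sm])
      fix c assume "c \<in> C"
      then have "0 \<le> p c" using p less_imp_le by blast
      then show "p c * norm_at c x \<le> 2 * norm x * (p c * (1 + norm c))"
        using mult_left_mono[OF norm_at_le[of c x], of "p c"] by (simp add: ac_simps)
    qed
    also have "\<dots> = 2 * norm x * D"
      unfolding D_def by (rule infsum_cmult_right[OF sm])
    also have "\<dots> \<le> (2 * D + 1) * norm x" by (simp add: algebra_simps)
    finally show ?thesis .
  qed
  then show ?thesis using that[of "2 * D + 1"] \<open>D \<ge> 0\<close> by force
qed

text \<open>By convexity no term of the series defining \<open>N\<close> contributes negatively to
  \<open>N (u + v) + N (u - v) - 2 * N u\<close>, so if this is small then so is every term.\<close>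

lemma asymptotic_norm_midpoint_defect:
  fixes N :: "'a::real_normed_vector \<Rightarrow> real"
  assumes "asymptotic_norm N" "\<eta> > 0"
  obtains \<delta> where "\<delta> > 0"
    "\<And>u v. \<lbrakk>norm u \<le> 1; norm v \<le> 1; N (u + v) + N (u - v) \<le> 2 * N u + \<delta>\<rbrakk>
      \<Longrightarrow> norm_at c (u + v) + norm_at c (u - v) \<le> 2 * norm_at c u + \<eta>"
proof -
  obtain C p where cl: "closure C = UNIV" and p: "\<And>c. c \<in> C \<Longrightarrow> 0 < p c"
    and sm: "(\<lambda>c. p c * (1 + norm c)) summable_on C"
    and N: "N = (\<lambda>x. \<Sum>\<^sub>\<infinity>c\<in>C. p c * norm_at c x)"
    using assms(1) unfolding asymptotic_norm_def by blast
  \<comment> \<open>The series has terms only for points of \<open>C\<close>, so \<open>c\<close> is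
    replaced by a nearby \<open>d\<close>. On vectors of norm at most 2 each replacement costs at
    most \<open>4 * (\<eta> / 48)\<close>, four of them at most \<open>\<eta> / 3\<close>; the term
    at \<open>d\<close> takes \<open>\<eta> / 2\<close>.\<close>
  have "c \<in> closure C" using cl by simp
  then obtain d where d: "d \<in> C" "norm (c - d) < \<eta> / 48"
    using \<open>\<eta> > 0\<close> unfolding closure_approachable dist_norm
    by (metis norm_minus_commute zero_less_divide_iff zero_less_numeral)
  note S = asymptotic_norm_summable[OF sm p]
  have "norm_at c (u + v) + norm_at c (u - v) \<le> 2 * norm_at c u + \<eta>"
    if u: "norm u \<le> 1" and v: "norm v \<le> 1"
      and le: "N (u + v) + N (u - v) \<le> 2 * N u + p d * (\<eta> / 2)" for u v
  proof -
    define g where "g b = norm_at b (u + v) + norm_at b (u - v) - 2 * norm_at b u" for b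
    have g0: "g b \<ge> 0" for b using norm_at_midpoint[of b u v] by (simp add: g_def)
    have "((\<lambda>b. p b * norm_at b (u + v) + p b * norm_at b (u - v) + (- 2) * (p b * norm_at b u))
        has_sum (N (u + v) + N (u - v) + (- 2) * N u)) C"
      unfolding N
      by (intro has_sum_add has_sum_cmult_right has_sum_infsum S)
    then have hs: "((\<lambda>b. p b * g b) has_sum (N (u + v) + N (u - v) - 2 * N u)) C"
      by (simp add: g_def algebra_simps)
    have "((\<lambda>b. p b * g b) has_sum p d * g d) {d}"
      using has_sum_finite[of "{d}" "\<lambda>b. p b * g b"] by simp
    then have "p d * g d \<le> N (u + v) + N (u - v) - 2 * N u"
      by (rule has_sum_mono2[OF _ hs]) (use d p g0 in \<open>auto intro!: mult_nonneg_nonneg simp: less_imp_le\<close>)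
    also have "\<dots> \<le> p d * (\<eta> / 2)" using le by simp
    finally have gd: "g d \<le> \<eta> / 2" using p[OF d(1)] by simp
    have L: "\<bar>norm_at c w - norm_at d w\<bar> \<le> 4 * (\<eta> / 48)" if "norm w \<le> 2" for w
    proof -
      have "2 * norm w * norm (c - d) \<le> 4 * (\<eta> / 48)"
        using that d(2) by (intro mult_mono) auto
      then show ?thesis using norm_at_Lipschitz[of c w d] by linarith
    qed
    have "norm (u + v) \<le> 2" "norm (u - v) \<le> 2" "norm u \<le> 2"
      using u v norm_triangle_ineq[of u v] norm_triangle_ineq4[of u v] by linarith+
    from L[OF this(1)] L[OF this(2)] L[OF this(3)] gd show ?thesis
      unfolding g_def by linarith
  qed
  then show ?thesis using that[of "p d * (\<eta> / 2)"] p[OF d(1)] \<open>\<eta> > 0\<close> by simp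
qed

subsection \<open>Norms along the array\<close>

text \<open>Each index may be taken beyond its predecessor, hence the general lower bound
  \<open>q\<close> in the induction. Combined with an iterated limit, this produces admissible
  indices at which the limit is nearly attained.\<close>

lemma iterated_eventually_increasing:
  "iterated_eventually n
    (\<lambda>is. length is = n \<and> sorted_wrt (<) is \<and> (\<forall>i\<in>set is. q \<le> i))"
proof (induction n arbitrary: q)
  case (Suc n)
  have "iterated_eventually n (\<lambda>is. length (i # is) = Suc n \<and> sorted_wrt (<) (i # is) \<and>
      (\<forall>j\<in>set (i # is). q \<le> j))" if "i \<ge> q" for i
    by (rule iterated_eventually_mono[OF Suc.IH[of "Suc i"]]) (use that in auto)
  then have "\<forall>\<^sub>F i in sequentially. iterated_eventually n (\<lambda>is. length (i # is) = Suc n \<and>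
      sorted_wrt (<) (i # is) \<and> (\<forall>j\<in>set (i # is). q \<le> j))"
    unfolding eventually_sequentially by blast
  then show ?case by simp
qed simp

lemma iterated_eventually_ex:
  assumes "iterated_eventually n P"
  shows "\<exists>is. P is"
proof (rule ccontr)
  assume "\<not> ?thesis"
  then have "iterated_eventually n (\<lambda>_. False)"
    using iterated_eventually_mono[OF assms] by auto
  then show False by (simp add: iterated_eventually_const)
qed

section \<open>From the model to norm bounds on the array\<close>

lemma norm_sum_c0_unit_le:
  assumes "\<And>j. j < n \<Longrightarrow> \<bar>b j\<bar> \<le> 1"
  shows "norm (\<Sum>j<n. b j *\<^sub>R c0_unit j) \<le> 1"
proof (rule norm_bound)
  fix k
  have "apply_bcontfun (\<Sum>j<m. b j *\<^sub>R c0_unit j) k = (if k < m then b k else 0)" for m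
    by (induction m) (auto simp: apply_c0_unit plus_bcontfun.rep_eq scaleR_bcontfun.rep_eq
        zero_bcontfun.rep_eq less_Suc_eq)
  then show "norm (apply_bcontfun (\<Sum>j<n. b j *\<^sub>R c0_unit j) k) \<le> 1"
    using assms by simp
qed

lemma norm_c0_unit: "norm (c0_unit i) = 1"
proof (rule antisym)
  show "norm (c0_unit i) \<le> 1"
    by (rule norm_bound) (simp add: apply_c0_unit)
  show "1 \<le> norm (c0_unit i)"
    using norm_bounded[of "c0_unit i" i] by (simp add: apply_c0_unit)
qed

text \<open>Equivalence with \<open>A * B \<le> 1\<close> determines the norm of the model only up
  to a factor. Normalization of the array gives \<open>norm (e 0) = 1\<close>, hence
  \<open>B \<ge> 1\<close> and \<open>A \<le> 1\<close>, and the supremum norm bounds the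
  rest.\<close>

lemma model_norm_le:
  assumes "basic_array N x" "asymptotic_model N x e" "equivalent_seqs 1 e c0_unit"
    and "\<And>j. j < n \<Longrightarrow> \<bar>b j\<bar> \<le> 1"
  shows "norm (\<Sum>j<n. b j *\<^sub>R e j) \<le> 1"
proof -
  have N1: "N (x r i) = 1" for r i
    using assms(1) unfolding basic_array_def by blast
  \<comment> \<open>The case of length one: all values \<open>N (x 0 i)\<close> equal 1, so their
    limit \<open>norm (e 0)\<close> does too.\<close>
  have "has_iterated_limit 1 (\<lambda>is. N (\<Sum>j<1. (1::real) *\<^sub>R x j (is ! j)))
      (norm (\<Sum>j<1. (1::real) *\<^sub>R e j))"
    using assms(2)[unfolded asymptotic_model_def, THEN conjunct2, rule_format, of 1 "\<lambda>_. 1"] .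
  then have "has_iterated_limit 1 (\<lambda>_. 1) (norm (e 0))" by (simp add: N1)
  moreover have "has_iterated_limit 1 (\<lambda>_. 1) 1"
    by (simp add: has_iterated_limit_def iterated_eventually_const)
  ultimately have e0: "norm (e 0) = 1" by (rule has_iterated_limit_unique)
  obtain A B where AB: "0 < A" "0 < B" "A * B \<le> 1"
    and eq: "\<And>n (a :: nat \<Rightarrow> real).
      inverse A * norm (\<Sum>i<n. a i *\<^sub>R e i) \<le> norm (\<Sum>i<n. a i *\<^sub>R c0_unit i) \<and>
      norm (\<Sum>i<n. a i *\<^sub>R c0_unit i) \<le> B * norm (\<Sum>i<n. a i *\<^sub>R e i)"
    using assms(3) unfolding equivalent_seqs_def by blast
  have "1 \<le> B" using eq[of "\<lambda>_. 1" 1] by (simp add: e0 norm_c0_unit)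
  then have "A \<le> 1" using AB by (smt (verit) mult_left_le mult_le_cancel_left1)
  have "inverse A * norm (\<Sum>j<n. b j *\<^sub>R e j) \<le> 1"
    using eq[of b n] norm_sum_c0_unit_le[of n b] assms(4) by fastforce
  then show ?thesis using \<open>A \<le> 1\<close> \<open>0 < A\<close>
    by (simp add: field_simps)
qed

text \<open>The iterated limit supplies one admissible tuple with value near the model norm, and the
  oscillation bound carries this to all tuples. As \<open>\<epsilon> R\<close> need not be small,
  the sum is read as one of length \<open>n \<ge> R\<close> with zero coefficients from
  \<open>R\<close> on.\<close>

lemma array_norm_le:
  assumes "basic_array N x" "asymptotic_model N x e" "equivalent_seqs 1 e c0_unit" "\<eta> > 0"
  obtains m where
    "\<And>i b. \<lbrakk>strict_mono i; m \<le> i 0; \<And>j. j < R \<Longrightarrow> \<bar>b j\<bar> \<le> 1\<rbrakk>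
      \<Longrightarrow> N (\<Sum>j<R. b j *\<^sub>R x j (i j)) \<le> 1 + \<eta>"
proof -
  obtain \<epsilon> :: "nat \<Rightarrow> real" where "\<epsilon> \<longlonglongrightarrow> 0" and
    osc: "\<And>n b i l. \<lbrakk>\<forall>j<n. b j \<in> {-1..1}; admissible_indices n i; admissible_indices n l\<rbrakk> \<Longrightarrow>
         \<bar>N (\<Sum>j<n. b j *\<^sub>R x j (i j)) - N (\<Sum>j<n. b j *\<^sub>R x j (l j))\<bar> < \<epsilon> n"
    using assms(2) unfolding asymptotic_model_def generates_asymptotic_model_def by metis
  then have "\<forall>\<^sub>F n in sequentially. \<epsilon> n < \<eta> / 2"
    using \<open>\<eta> > 0\<close> by (intro order_tendstoD) auto
  then obtain n where n: "n \<ge> R" "\<epsilon> n < \<eta> / 2"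
    unfolding eventually_sequentially by (metis max.cobounded1 max.cobounded2)
  have "N (\<Sum>j<R. b j *\<^sub>R x j (i j)) \<le> 1 + \<eta>"
    if i: "strict_mono i" "n \<le> i 0" and b: "\<And>j. j < R \<Longrightarrow> \<bar>b j\<bar> \<le> 1" for i b
  proof -
    define b' where "b' j = (if j < R then b j else 0)" for j
    have b': "\<bar>b' j\<bar> \<le> 1" for j using b by (simp add: b'_def)
    have adm_i: "admissible_indices n i"
      unfolding admissible_indices_def
      using i(2) strict_mono_less_eq[OF i(1), of 0] strict_mono_less[OF i(1)]
      by (auto simp: strict_mono_on_def intro: order_trans)
    have "has_iterated_limit n (\<lambda>is. N (\<Sum>j<n. b' j *\<^sub>R x j (is ! j))) (norm (\<Sum>j<n. b' j *\<^sub>R e j))"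
      using assms(2) by (simp add: asymptotic_model_def)
    from this[unfolded has_iterated_limit_def, rule_format, of "\<eta> / 2"]
    have "iterated_eventually n (\<lambda>is.
        \<bar>N (\<Sum>j<n. b' j *\<^sub>R x j (is ! j)) - norm (\<Sum>j<n. b' j *\<^sub>R e j)\<bar> < \<eta> / 2)"
      using \<open>\<eta> > 0\<close> by simp
    from iterated_eventually_ex[OF iterated_eventually_conj[OF this
          iterated_eventually_increasing[of n n]]]
    obtain js where js: "length js = n" "sorted_wrt (<) js" "\<forall>j\<in>set js. n \<le> j"
      and N_js: "\<bar>N (\<Sum>j<n. b' j *\<^sub>R x j (js ! j)) - norm (\<Sum>j<n. b' j *\<^sub>R e j)\<bar> < \<eta> / 2"
      by blast
    have "admissible_indices n (\<lambda>j. js ! j)"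
      using js by (auto simp: admissible_indices_def strict_mono_on_def sorted_wrt_iff_nth_less)
    from osc[OF _ adm_i this, of b'] b'
    have "\<bar>N (\<Sum>j<n. b' j *\<^sub>R x j (i j)) - N (\<Sum>j<n. b' j *\<^sub>R x j (js ! j))\<bar> < \<epsilon> n"
      by (auto simp: abs_le_iff minus_le_iff)
    moreover have "norm (\<Sum>j<n. b' j *\<^sub>R e j) \<le> 1"
      by (rule model_norm_le[OF assms(1-3)]) (rule b')
    ultimately have "N (\<Sum>j<n. b' j *\<^sub>R x j (i j)) \<le> 1 + \<eta>"
      using N_js n(2) by linarith
    also have "(\<Sum>j<n. b' j *\<^sub>R x j (i j)) = (\<Sum>j<R. b j *\<^sub>R x j (i j))"
      by (rule sum.mono_neutral_cong_right) (use n(1) in \<open>auto simp: b'_def\<close>)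
    finally show ?thesis .
  qed
  then show ?thesis using that by blast
qed

lemma array_norm_pair_le:
  assumes "basic_array N x" "asymptotic_model N x e" "equivalent_seqs 1 e c0_unit" "\<eta> > 0" "r < s"
  obtains k where
    "\<And>m n b. \<lbrakk>k \<le> m; m + s \<le> n; \<bar>b\<bar> \<le> 1\<rbrakk> \<Longrightarrow> N (x r m + b *\<^sub>R x s n) \<le> 1 + \<eta>"
proof -
  obtain k where k: "\<And>i b. \<lbrakk>strict_mono i; k \<le> i 0; \<And>j. j < Suc s \<Longrightarrow> \<bar>b j\<bar> \<le> 1\<rbrakk>
      \<Longrightarrow> N (\<Sum>j<Suc s. b j *\<^sub>R x j (i j)) \<le> 1 + \<eta>"
    using array_norm_le[OF assms(1-4), of "Suc s"] by metis
  have "N (x r m + b *\<^sub>R x s n) \<le> 1 + \<eta>" if "k + r \<le> m" "m + s \<le> n" "\<bar>b\<bar> \<le> 1" for m n b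
  proof -
    \<comment> \<open>A strictly increasing index sequence with \<open>i r = m\<close> and
      \<open>i s = n\<close>. The condition \<open>k + r \<le> m\<close> gives
      \<open>k \<le> i 0\<close>, and \<open>m + s \<le> n\<close> leaves room for the jump at
      \<open>s\<close>.\<close>
    define i where "i j = (if j < s then m - r + j else n + (j - s))" for j
    define a where "a j = (if j = r then 1 else if j = s then b else 0)" for j
    have "strict_mono i"
      using that by (auto simp: strict_mono_def i_def)
    moreover have "k \<le> i 0" using that assms(5) by (auto simp: i_def)
    moreover have "\<bar>a j\<bar> \<le> 1" for j using that by (simp add: a_def)
    ultimately have "N (\<Sum>j<Suc s. a j *\<^sub>R x j (i j)) \<le> 1 + \<eta>" by (intro k)
    also have "(\<Sum>j<Suc s. a j *\<^sub>R x j (i j)) = (\<Sum>j\<in>{r, s}. a j *\<^sub>R x j (i j))"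
      by (rule sum.mono_neutral_right) (use assms(5) in \<open>auto simp: a_def\<close>)
    also have "\<dots> = x r m + b *\<^sub>R x s n"
      using assms(5) that by (simp add: a_def i_def)
    finally show ?thesis .
  qed
  then show ?thesis by (rule that)
qed

section \<open>Limits along the rows\<close>

lemma asymptotic_norm_minus: "asymptotic_norm N \<Longrightarrow> N (- x) = N x"
  unfolding asymptotic_norm_def by (auto simp: norm_at_minus)

lemma asymptotic_norm_ge: "asymptotic_norm N \<Longrightarrow> norm x \<le> N x"
  unfolding asymptotic_norm_def by auto

lemma basic_array_normalized: "basic_array N x \<Longrightarrow> N (x n i) = 1"
  unfolding basic_array_def by blast

text \<open>This is the bridge from \<open>norm_at\<close> to \<open>\<phi>\<close>: asymptotically
  \<open>norm_at c\<close> is a symmetric pair of norms around the fixed vector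
  \<open>L *\<^sub>R c\<close>.\<close>

lemma norm_at_diff_tendsto_0:
  assumes "((\<lambda>m. norm (z m)) \<longlongrightarrow> L) F"
  shows "((\<lambda>m. norm_at c (z m) - (norm (L *\<^sub>R c + z m) + norm (L *\<^sub>R c - z m))) \<longlongrightarrow> 0) F"
proof (rule Lim_null_comparison)
  show "\<forall>\<^sub>F m in F. norm (norm_at c (z m) - (norm (L *\<^sub>R c + z m) + norm (L *\<^sub>R c - z m)))
      \<le> 2 * (\<bar>norm (z m) - L\<bar> * norm c)"
    using norm_at_diff_scaled[of c "z _" L c]
    by (intro always_eventually allI) (simp flip: scaleR_diff_left)
  have "((\<lambda>m. 2 * (\<bar>norm (z m) - L\<bar> * norm c)) \<longlongrightarrow> 2 * (\<bar>L - L\<bar> * norm c)) F"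
    by (intro tendsto_intros assms)
  then show "((\<lambda>m. 2 * (\<bar>norm (z m) - L\<bar> * norm c)) \<longlongrightarrow> 0) F" by simp
qed

text \<open>For entries \<open>u\<close>, \<open>v\<close> of the two rows, \<open>N (u + v)\<close>
  and \<open>N (u - v)\<close> are at most slightly above 1 while \<open>N u = N v = 1\<close>. So
  the midpoint defect is small around \<open>u\<close> and, with the roles exchanged, around
  \<open>v\<close>; hence the minimum.\<close>

lemma array_pair_defect:
  fixes N :: "'a::real_normed_vector \<Rightarrow> real"
  assumes N: "asymptotic_norm N"
    and x: "basic_array N x" "asymptotic_model N x e" "equivalent_seqs 1 e c0_unit"
    and "\<eta> > 0" "r < s"
  obtains k where "\<And>m n. \<lbrakk>k \<le> m; m + s \<le> n\<rbrakk> \<Longrightarrow>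
    norm_at c (x r m + x s n) + norm_at c (x r m - x s n)
      \<le> 2 * min (norm_at c (x r m)) (norm_at c (x s n)) + \<eta>"
proof -
  obtain \<delta> where "\<delta> > 0" and \<delta>:
    "\<And>u v. \<lbrakk>norm u \<le> 1; norm v \<le> 1; N (u + v) + N (u - v) \<le> 2 * N u + \<delta>\<rbrakk>
      \<Longrightarrow> norm_at c (u + v) + norm_at c (u - v) \<le> 2 * norm_at c u + \<eta>"
    using asymptotic_norm_midpoint_defect[OF N \<open>\<eta> > 0\<close>] by metis
  obtain k where k: "\<And>m n b. \<lbrakk>k \<le> m; m + s \<le> n; \<bar>b\<bar> \<le> 1\<rbrakk> \<Longrightarrow> N (x r m + b *\<^sub>R x s n) \<le> 1 + \<delta> / 2"
    using array_norm_pair_le[OF x, of "\<delta> / 2", OF _ \<open>r < s\<close>] \<open>\<delta> > 0\<close> by auto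
  have "norm_at c (x r m + x s n) + norm_at c (x r m - x s n)
      \<le> 2 * min (norm_at c (x r m)) (norm_at c (x s n)) + \<eta>" if "k \<le> m" "m + s \<le> n" for m n
  proof -
    let ?u = "x r m" and ?v = "x s n"
    have 1: "N ?u = 1" "N ?v = 1" "norm ?u \<le> 1" "norm ?v \<le> 1"
      using basic_array_normalized[OF x(1)] asymptotic_norm_ge[OF N] by metis+
    have 2: "N (?u + ?v) \<le> 1 + \<delta> / 2" "N (?u - ?v) \<le> 1 + \<delta> / 2"
      using k[OF that, of 1] k[OF that, of "-1"] by simp_all
    have 3: "N (?v - ?u) = N (?u - ?v)" "norm_at c (?v - ?u) = norm_at c (?u - ?v)"
      using asymptotic_norm_minus[OF N, of "?u - ?v"] norm_at_minus[of c "?u - ?v"] by simp_all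
    show ?thesis
      using \<delta>[of ?u ?v] \<delta>[of ?v ?u] 1 2 3 by (simp add: add.commute)
  qed
  then show ?thesis by (rule that)
qed

text \<open>Midpoint convexity around each of two entries bounds the sum in
  \<open>array_pair_defect\<close> below by twice the larger value, while that lemma bounds it above
  by nearly twice the smaller one. So entries of row 0 and later entries of another row have nearly
  equal \<open>norm_at c\<close>.\<close>

lemma norm_at_array_tendsto:
  fixes N :: "'a::real_normed_vector \<Rightarrow> real"
  assumes N: "asymptotic_norm N"
    and x: "basic_array N x" "asymptotic_model N x e" "equivalent_seqs 1 e c0_unit"
  obtains l where "\<And>r. (\<lambda>m. norm_at c (x r m)) \<longlonglongrightarrow> l"
proof -
  have close: "\<exists>k. \<forall>m\<ge>k. \<forall>n\<ge>m + s. \<bar>norm_at c (x 0 m) - norm_at c (x s n)\<bar> \<le> \<eta>"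
    if \<eta>: "\<eta> > 0" and s: "0 < s" for \<eta> s
  proof -
    obtain k where k: "\<And>m n. \<lbrakk>k \<le> m; m + s \<le> n\<rbrakk> \<Longrightarrow>
      norm_at c (x 0 m + x s n) + norm_at c (x 0 m - x s n)
        \<le> 2 * min (norm_at c (x 0 m)) (norm_at c (x s n)) + \<eta>"
      using array_pair_defect[OF N x \<eta> s] by metis
    have "\<bar>norm_at c (x 0 m) - norm_at c (x s n)\<bar> \<le> \<eta>" if "k \<le> m" "m + s \<le> n" for m n
      using k[OF that] norm_at_midpoint[of c "x 0 m" "x s n"] norm_at_midpoint[of c "x s n" "x 0 m"]
        norm_at_minus[of c "x 0 m - x s n"] \<eta>
      by (simp add: add.commute)
    then show ?thesis by blast
  qed
  have "Cauchy (\<lambda>m. norm_at c (x 0 m))"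
  proof (rule CauchyI)
    fix \<epsilon> :: real assume "\<epsilon> > 0"
    then obtain k where k: "\<And>m n. \<lbrakk>k \<le> m; m + 1 \<le> n\<rbrakk> \<Longrightarrow>
        \<bar>norm_at c (x 0 m) - norm_at c (x 1 n)\<bar> \<le> \<epsilon> / 3"
      using close[of "\<epsilon> / 3" 1] by auto
    have "norm (norm_at c (x 0 m) - norm_at c (x 0 n)) < \<epsilon>" if "k \<le> m" "k \<le> n" for m n
    proof -
      \<comment> \<open>Two entries of row 0 are compared through a common entry of row 1 beyond
        both.\<close>
      have "\<bar>norm_at c (x 0 m) - norm_at c (x 1 (m + n + 1))\<bar> \<le> \<epsilon> / 3"
        "\<bar>norm_at c (x 0 n) - norm_at c (x 1 (m + n + 1))\<bar> \<le> \<epsilon> / 3"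
        by (rule k; use that in simp)+
      then show ?thesis using \<open>\<epsilon> > 0\<close> unfolding real_norm_def by linarith
    qed
    then show "\<exists>k. \<forall>m\<ge>k. \<forall>n\<ge>k. norm (norm_at c (x 0 m) - norm_at c (x 0 n)) < \<epsilon>" by blast
  qed
  then obtain l where l: "(\<lambda>m. norm_at c (x 0 m)) \<longlonglongrightarrow> l"
    using Cauchy_convergent convergent_def by blast
  have "(\<lambda>m. norm_at c (x r m)) \<longlonglongrightarrow> l" for r
  proof (cases "r = 0")
    case False
    show ?thesis
    proof (rule LIMSEQ_I)
      fix \<epsilon> :: real assume "\<epsilon> > 0"
      obtain k where k: "\<And>m n. \<lbrakk>k \<le> m; m + r \<le> n\<rbrakk> \<Longrightarrow>
          \<bar>norm_at c (x 0 m) - norm_at c (x r n)\<bar> \<le> \<epsilon> / 2"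
        using close[of "\<epsilon> / 2" r] False \<open>\<epsilon> > 0\<close> by auto
      obtain k' where k': "\<And>m. k' \<le> m \<Longrightarrow> \<bar>norm_at c (x 0 m) - l\<bar> < \<epsilon> / 2"
        using LIMSEQ_D[OF l, of "\<epsilon> / 2"] \<open>\<epsilon> > 0\<close> by auto
      have "norm (norm_at c (x r n) - l) < \<epsilon>" if "k + k' + r \<le> n" for n
      proof -
        \<comment> \<open>\<open>n - r\<close> is the largest index of row 0 with the required gap
          \<open>r\<close> before \<open>n\<close>.\<close>
        have "\<bar>norm_at c (x 0 (n - r)) - norm_at c (x r n)\<bar> \<le> \<epsilon> / 2"
          by (rule k) (use that in auto)
        moreover have "\<bar>norm_at c (x 0 (n - r)) - l\<bar> < \<epsilon> / 2"
          by (rule k') (use that in auto)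
        ultimately show ?thesis unfolding real_norm_def by linarith
      qed
      then show "\<exists>n0. \<forall>n\<ge>n0. norm (norm_at c (x r n) - l) < \<epsilon>" by blast
    qed
  qed (use l in simp)
  then show ?thesis by (rule that)
qed

text \<open>With \<open>y = L *\<^sub>R c\<close> the pair of norms differs from
  \<open>norm_at c (x r m)\<close> by a null sequence, so it inherits a limit common to all rows.
  The case \<open>c = 0\<close> gives \<open>L\<close>.\<close>

lemma norm_pair_array_tendsto:
  fixes N :: "'a::real_normed_vector \<Rightarrow> real"
  assumes N: "asymptotic_norm N"
    and x: "basic_array N x" "asymptotic_model N x e" "equivalent_seqs 1 e c0_unit"
  obtains L \<phi> where "L > 0" "\<And>r. (\<lambda>m. norm (x r m)) \<longlonglongrightarrow> L"
    "\<And>r y. (\<lambda>m. norm (y + x r m) + norm (y - x r m)) \<longlonglongrightarrow> \<phi> y"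
proof -
  obtain l0 where "\<And>r. (\<lambda>m. norm_at 0 (x r m)) \<longlonglongrightarrow> l0"
    using norm_at_array_tendsto[OF N x] by metis
  then have L: "(\<lambda>m. norm (x r m)) \<longlonglongrightarrow> l0 / 2" for r
    using tendsto_divide[of "\<lambda>m. norm_at 0 (x r m)" l0 sequentially "\<lambda>_. 2" 2]
    by (simp add: norm_at_0)
  define L where "L = l0 / 2"
  note L = L[folded L_def]
  obtain D where D: "D > 0" "\<And>x. N x \<le> D * norm x"
    using asymptotic_norm_bounded[OF N] by blast
  have "1 / D \<le> norm (x 0 m)" for m
    using D(1) D(2)[of "x 0 m"] basic_array_normalized[OF x(1), of 0 m] by (simp add: field_simps)
  then have "1 / D \<le> L" using LIMSEQ_le_const[OF L[of 0]] by blast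
  then have "L > 0" using D(1) by (smt (verit) divide_pos_pos)
  have "\<exists>l. \<forall>r. (\<lambda>m. norm (y + x r m) + norm (y - x r m)) \<longlonglongrightarrow> l" for y
  proof -
    define c where "c = (1 / L) *\<^sub>R y"
    have y: "y = L *\<^sub>R c" using \<open>L > 0\<close> by (simp add: c_def)
    obtain l where l: "\<And>r. (\<lambda>m. norm_at c (x r m)) \<longlonglongrightarrow> l"
      using norm_at_array_tendsto[OF N x] by metis
    have "(\<lambda>m. norm (y + x r m) + norm (y - x r m)) \<longlonglongrightarrow> l" for r
    proof -
      from tendsto_diff[OF l[of r] norm_at_diff_tendsto_0[OF L[of r], of c]]
      show ?thesis by (simp add: y)
    qed
    then show ?thesis by blast
  qed
  then obtain \<phi> where "\<And>y r. (\<lambda>m. norm (y + x r m) + norm (y - x r m)) \<longlonglongrightarrow> \<phi> y" by metis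
  with that \<open>L > 0\<close> L show ?thesis by blast
qed

subsection \<open>Averaging over signs\<close>

text \<open>For a suitable choice of signs \<open>\<theta>\<close> Jensen's inequality gives that the average of
  \<open>h (y + \<theta> j *\<^sub>R v j)\<close> is close to \<open>h y\<close>, because \<open>\<Sum>j\<in>J. \<theta> j *\<^sub>R v j\<close> is
  bounded while \<open>J\<close> is large.\<close>

lemma sum_deviation_le:
  fixes h :: "'a::real_normed_vector \<Rightarrow> real" and v :: "'b \<Rightarrow> 'a" and M B \<eta> :: real
  assumes conv: "convex_on UNIV h" and lip: "\<And>u w. \<bar>h u - h w\<bar> \<le> M * norm (u - w)"
    and J: "finite J" "J \<noteq> {}"
    and B: "\<And>\<theta>. (\<And>j. \<theta> j \<in> {-1, 1::real}) \<Longrightarrow> norm (\<Sum>j\<in>J. \<theta> j *\<^sub>R v j) \<le> B"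
    and le: "\<And>j. j \<in> J \<Longrightarrow> h (y + v j) + h (y - v j) \<le> 2 * h y + \<eta>"
    and "M \<ge> 0"
  shows "(\<Sum>j\<in>J. max (h (y + v j)) (h (y - v j)) - h y) \<le> card J * \<eta> + M * B"
proof -
  \<comment> \<open>The sign selects the smaller of the two values. Jensen bounds the sum of the
    smaller values from below, and \<open>le\<close> turns this into an upper bound on the larger
    ones.\<close>
  define \<theta> :: "'b \<Rightarrow> real" where "\<theta> j = (if h (y + v j) \<le> h (y - v j) then 1 else -1)" for j
  define k where "k = real (card J)"
  have "k > 0" using J by (simp add: k_def card_gt_0_iff)
  have \<theta>: "\<theta> j \<in> {-1, 1}" for j by (simp add: \<theta>_def)
  let ?S = "\<Sum>j\<in>J. \<theta> j *\<^sub>R v j"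
  have "h y - h (y + (1 / k) *\<^sub>R ?S) \<le> M * norm ((1 / k) *\<^sub>R ?S)"
    using lip[of y "y + (1 / k) *\<^sub>R ?S"] by simp
  also have "\<dots> \<le> M * (B / k)"
    using B[OF \<theta>] \<open>k > 0\<close> \<open>M \<ge> 0\<close> by (intro mult_left_mono) (auto simp: field_simps)
  finally have "k * h y - M * B \<le> k * h (y + (1 / k) *\<^sub>R ?S)"
    using \<open>k > 0\<close> by (simp add: field_simps)
  also have "h (y + (1 / k) *\<^sub>R ?S) = h (\<Sum>j\<in>J. (1 / k) *\<^sub>R (y + \<theta> j *\<^sub>R v j))"
  proof -
    have "(\<Sum>j\<in>J. (1 / k) *\<^sub>R (y + \<theta> j *\<^sub>R v j)) = (\<Sum>j\<in>J. (1 / k) *\<^sub>R y) + (1 / k) *\<^sub>R ?S"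
      by (simp add: scaleR_add_right sum.distrib scaleR_sum_right)
    also have "(\<Sum>j\<in>J. (1 / k) *\<^sub>R y) = y"
      using \<open>k > 0\<close> by (simp add: k_def sum_constant_scaleR)
    finally show ?thesis by simp
  qed
  also have "k * \<dots> \<le> k * (\<Sum>j\<in>J. (1 / k) * h (y + \<theta> j *\<^sub>R v j))"
    using \<open>k > 0\<close> by (intro mult_left_mono convex_on_sum[OF J conv]) (auto simp: k_def)
  also have "\<dots> = (\<Sum>j\<in>J. h (y + \<theta> j *\<^sub>R v j))"
    using \<open>k > 0\<close> by (simp add: sum_distrib_left)
  finally have min_ge: "k * h y - M * B \<le> (\<Sum>j\<in>J. h (y + \<theta> j *\<^sub>R v j))" .
  have "(\<Sum>j\<in>J. max (h (y + v j)) (h (y - v j)) - h y) \<le> (\<Sum>j\<in>J. \<eta> + h y - h (y + \<theta> j *\<^sub>R v j))"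
    by (rule sum_mono) (use le in \<open>force simp: \<theta>_def max_def\<close>)
  also have "\<dots> = k * \<eta> + k * h y - (\<Sum>j\<in>J. h (y + \<theta> j *\<^sub>R v j))"
    by (simp add: sum_subtractf sum.distrib k_def distrib_left)
  finally show ?thesis using min_ge by (simp add: k_def)
qed

text \<open>Pigeonhole over \<open>J\<close>. One index must serve all of \<open>Y\<close>, so the
  deviations are summed over \<open>Y\<close> first; they are nonnegative by convexity, so each is
  at most that sum.\<close>

lemma exists_small_deviation:
  fixes h :: "'a::real_normed_vector \<Rightarrow> real" and v :: "'b \<Rightarrow> 'a" and M B \<eta> :: real
  assumes conv: "convex_on UNIV h" and lip: "\<And>u w. \<bar>h u - h w\<bar> \<le> M * norm (u - w)"
    and J: "finite J" "J \<noteq> {}" and Y: "finite Y"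
    and B: "\<And>\<theta>. (\<And>j. \<theta> j \<in> {-1, 1::real}) \<Longrightarrow> norm (\<Sum>j\<in>J. \<theta> j *\<^sub>R v j) \<le> B"
    and le: "\<And>j y. \<lbrakk>j \<in> J; y \<in> Y\<rbrakk> \<Longrightarrow> h (y + v j) + h (y - v j) \<le> 2 * h y + \<eta>"
    and "M \<ge> 0"
  shows "\<exists>j\<in>J. \<forall>y\<in>Y. max (h (y + v j)) (h (y - v j)) \<le> h y + card Y * (\<eta> + M * B / card J)"
proof -
  define D where "D j y = max (h (y + v j)) (h (y - v j)) - h y" for j y
  have D0: "D j y \<ge> 0" for j y
  proof -
    have "h ((1/2) *\<^sub>R (y + v j) + (1/2) *\<^sub>R (y - v j)) \<le> (1/2) * h (y + v j) + (1/2) * h (y - v j)"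
      using conv[unfolded convex_on_def, THEN conjunct2, rule_format, of "y + v j" "y - v j" "1/2" "1/2"] by simp
    moreover have "(1/2) *\<^sub>R (y + v j) + (1/2) *\<^sub>R (y - v j) = y"
      by (simp add: algebra_simps flip: scaleR_add_left)
    ultimately show ?thesis by (simp add: D_def)
  qed
  have k: "real (card J) > 0" using J by (simp add: card_gt_0_iff)
  have "\<exists>j\<in>J. (\<Sum>y\<in>Y. D j y) \<le> card Y * (\<eta> + M * B / card J)"
  proof (rule ccontr)
    assume "\<not> ?thesis"
    then have "(\<Sum>j\<in>J. card Y * (\<eta> + M * B / card J)) < (\<Sum>j\<in>J. \<Sum>y\<in>Y. D j y)"
      using J by (intro sum_strict_mono) auto
    also have "\<dots> = (\<Sum>y\<in>Y. \<Sum>j\<in>J. D j y)" by (rule sum.swap)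
    also have "\<dots> \<le> (\<Sum>y\<in>Y. card J * \<eta> + M * B)"
      unfolding D_def by (intro sum_mono sum_deviation_le[OF conv lip J B le \<open>M \<ge> 0\<close>])
    finally show False using k by (simp add: field_simps)
  qed
  then obtain j where j: "j \<in> J" "(\<Sum>y\<in>Y. D j y) \<le> card Y * (\<eta> + M * B / card J)" ..
  have "D j y \<le> card Y * (\<eta> + M * B / card J)" if "y \<in> Y" for y
    using member_le_sum[OF that, of "D j"] Y D0 j(2) by force
  with j(1) show ?thesis by (force simp: D_def)
qed

subsection \<open>Isomorphs of \<open>c\<^sub>0\<close>\<close>

text \<open>The cube of coefficients is the convex hull of its sign vectors, and the norm is convex.
  The induction replaces one sign at a time by the real coefficient.\<close>

lemma norm_signed_sum_bound:
  fixes y :: "nat \<Rightarrow> 'a::real_normed_vector"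
  assumes "\<And>\<theta>. (\<And>k. \<theta> k \<in> {-1, 1::real}) \<Longrightarrow> norm (\<Sum>k<n. \<theta> k *\<^sub>R y k) \<le> M"
    and "\<And>k. k < n \<Longrightarrow> \<bar>b k\<bar> \<le> 1"
  shows "norm (\<Sum>k<n. b k *\<^sub>R y k) \<le> M"
proof -
  have "norm ((\<Sum>k<m. b k *\<^sub>R y k) + (\<Sum>k=m..<n. \<theta> k *\<^sub>R y k)) \<le> M"
    if "m \<le> n" "\<And>k. \<theta> k \<in> {-1, 1::real}" for m \<theta>
    using that
  proof (induction m arbitrary: \<theta>)
    case 0
    then show ?case using assms(1)[of \<theta>] by (simp add: atLeast0LessThan)
  next
    case (Suc m)
    \<comment> \<open>The weight with \<open>b m = l * 1 + (1 - l) * (-1)\<close>.\<close>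
    define l where "l = (1 + b m) / 2"
    have l: "0 \<le> l" "l \<le> 1" using assms(2)[of m] Suc.prems(1) by (auto simp: l_def)
    let ?S = "(\<Sum>k<m. b k *\<^sub>R y k) + (\<Sum>k=Suc m..<n. \<theta> k *\<^sub>R y k)"
    have flip: "norm (?S + s *\<^sub>R y m) \<le> M" if "s \<in> {-1, 1}" for s
    proof -
      have "norm ((\<Sum>k<m. b k *\<^sub>R y k) + (\<Sum>k=m..<n. (\<theta>(m := s)) k *\<^sub>R y k)) \<le> M"
        by (rule Suc.IH) (use Suc.prems that in auto)
      also have "(\<Sum>k=m..<n. (\<theta>(m := s)) k *\<^sub>R y k) = s *\<^sub>R y m + (\<Sum>k=Suc m..<n. \<theta> k *\<^sub>R y k)"
        using Suc.prems(1) by (subst sum.atLeast_Suc_lessThan) auto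
      finally show ?thesis by (simp add: algebra_simps)
    qed
    have "(\<Sum>k<Suc m. b k *\<^sub>R y k) + (\<Sum>k=Suc m..<n. \<theta> k *\<^sub>R y k)
        = l *\<^sub>R (?S + 1 *\<^sub>R y m) + (1 - l) *\<^sub>R (?S + (-1) *\<^sub>R y m)"
    proof -
      have "l *\<^sub>R (?S + 1 *\<^sub>R y m) + (1 - l) *\<^sub>R (?S + (-1) *\<^sub>R y m) = ?S + (2 * l - 1) *\<^sub>R y m"
        by (simp add: algebra_simps flip: scaleR_2)
      also have "2 * l - 1 = b m" by (simp add: l_def field_simps)
      finally show ?thesis by (simp add: algebra_simps)
    qed
    also have "norm \<dots> \<le> l * M + (1 - l) * M"
      using l by (intro norm_triangle_mono) (use flip[of 1] flip[of "-1"] in \<open>auto intro!: mult_left_mono\<close>)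
    finally show ?case by (simp add: algebra_simps)
  qed
  from this[of n "\<lambda>_. 1"] show ?thesis by simp
qed

text \<open>The lower bound needs no basic sequence: flipping the sign of the \<open>k\<close>-th term of a sum
  changes it by \<open>2 * f k *\<^sub>R y k\<close>.\<close>

lemma contains_c0I:
  fixes y :: "nat \<Rightarrow> 'a::banach"
  assumes M: "\<And>n \<theta>. (\<And>k. \<theta> k \<in> {-1, 1::real}) \<Longrightarrow> norm (\<Sum>k<n. \<theta> k *\<^sub>R y k) \<le> M"
    and \<delta>: "\<And>k. \<delta> \<le> norm (y k)" and "M < 2 * \<delta>"
  shows "contains_isomorph TYPE('a) c0"
proof -
  have "M \<ge> 0" using M[of "\<lambda>_. 1" 0] by simp
  have bd: "norm (\<Sum>k<n. b k *\<^sub>R y k) \<le> M * c" if "\<And>k. \<bar>b k\<bar> \<le> c" for b c n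
  proof (cases "c = 0")
    case True
    then show ?thesis using that by simp
  next
    case False
    then have "c > 0" using that[of 0] by linarith
    have "norm (\<Sum>k<n. (b k / c) *\<^sub>R y k) \<le> M"
      by (rule norm_signed_sum_bound[OF M]) (use that \<open>c > 0\<close> in auto)
    also have "(\<Sum>k<n. (b k / c) *\<^sub>R y k) = (1 / c) *\<^sub>R (\<Sum>k<n. b k *\<^sub>R y k)"
      by (simp add: scaleR_sum_right)
    finally show ?thesis using \<open>c > 0\<close> by (simp add: field_simps)
  qed
  have sm: "summable (\<lambda>k. f k *\<^sub>R y k)" if f: "f \<longlonglongrightarrow> 0" for f :: "nat \<Rightarrow> real"
  proof -
    have "Cauchy (\<lambda>n. \<Sum>k<n. f k *\<^sub>R y k)"
    proof (rule CauchyI')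
      fix \<epsilon> :: real assume "\<epsilon> > 0"
      \<comment> \<open>The denominator \<open>M + 1\<close> yields
        \<open>M * c < \<epsilon>\<close> even for \<open>M = 0\<close>.\<close>
      define c where "c = \<epsilon> / (M + 1)"
      have "c > 0" using \<open>\<epsilon> > 0\<close> \<open>M \<ge> 0\<close> by (simp add: c_def)
      then obtain n0 where n0: "\<And>k. k \<ge> n0 \<Longrightarrow> \<bar>f k\<bar> < c"
        using LIMSEQ_D[OF f \<open>c > 0\<close>] by auto
      have "dist (\<Sum>k<m. f k *\<^sub>R y k) (\<Sum>k<n. f k *\<^sub>R y k) < \<epsilon>" if "n0 \<le> m" "m < n" for m n
      proof -
        have "(\<Sum>k<n. f k *\<^sub>R y k) = (\<Sum>k<m. f k *\<^sub>R y k) + (\<Sum>k=m..<n. f k *\<^sub>R y k)"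
          using that sum.atLeastLessThan_concat[of 0 m n "\<lambda>k. f k *\<^sub>R y k"]
          by (simp add: atLeast0LessThan)
        \<comment> \<open>Padding with zeros brings the block from \<open>m\<close> to
          \<open>n\<close> into the form required by \<open>bd\<close>.\<close>
        moreover have "(\<Sum>k<n. (if m \<le> k then f k else 0) *\<^sub>R y k) = (\<Sum>k=m..<n. f k *\<^sub>R y k)"
          by (rule sum.mono_neutral_cong_right) auto
        moreover have "norm (\<Sum>k<n. (if m \<le> k then f k else 0) *\<^sub>R y k) \<le> M * c"
          by (rule bd) (use n0 that \<open>c > 0\<close> in \<open>auto intro: less_imp_le\<close>)
        moreover have "M * c < \<epsilon>"
          using \<open>\<epsilon> > 0\<close> \<open>M \<ge> 0\<close> by (simp add: c_def field_simps)
        ultimately show ?thesis by (simp add: dist_norm norm_minus_commute)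
      qed
      then show "\<exists>n0. \<forall>m\<ge>n0. \<forall>n>m. dist (\<Sum>k<m. f k *\<^sub>R y k) (\<Sum>k<n. f k *\<^sub>R y k) < \<epsilon>"
        by blast
    qed
    then show ?thesis by (simp add: summable_iff_convergent Cauchy_convergent)
  qed
  define T where "T f = (\<Sum>k. apply_bcontfun f k *\<^sub>R y k)" for f :: "nat \<Rightarrow>\<^sub>C real"
  have lim: "(\<lambda>n. \<Sum>k<n. apply_bcontfun f k *\<^sub>R y k) \<longlonglongrightarrow> T f" if "f \<in> c0" for f
    using summable_LIMSEQ[OF sm] that by (simp add: c0_def T_def)
  have upper: "norm (T f) \<le> M * norm f" if "f \<in> c0" for f
    by (rule Lim_norm_ubound[OF _ lim[OF that]])
      (auto intro!: always_eventually bd norm_bounded[of f, simplified])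
  have lower: "(2 * \<delta> - M) * norm f \<le> norm (T f)" if f: "f \<in> c0" for f
  proof -
    have k_le: "2 * \<delta> * \<bar>apply_bcontfun f k\<bar> \<le> norm (T f) + M * norm f" for k
    proof -
      let ?S = "\<lambda>n. \<Sum>k<n. apply_bcontfun f k *\<^sub>R y k"
      have "2 * \<delta> * \<bar>apply_bcontfun f k\<bar> \<le> norm (?S n) + M * norm f" if "k < n" for n
      proof -
        define g where "g j = (if j = k then - apply_bcontfun f k else apply_bcontfun f j)" for j
        have "(\<Sum>j<n. g j *\<^sub>R y j) = g k *\<^sub>R y k + (\<Sum>j\<in>{..<n} - {k}. g j *\<^sub>R y j)"
          using that by (subst sum.remove[of _ k]) auto
        moreover have "?S n = apply_bcontfun f k *\<^sub>R y k + (\<Sum>j\<in>{..<n} - {k}. g j *\<^sub>R y j)"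
          using that by (subst sum.remove[of _ k]) (auto simp: g_def)
        ultimately have "(2 * apply_bcontfun f k) *\<^sub>R y k = ?S n - (\<Sum>j<n. g j *\<^sub>R y j)"
          by (simp add: g_def scaleR_2 flip: scaleR_scaleR)
        then have "norm ((2 * apply_bcontfun f k) *\<^sub>R y k) \<le> norm (?S n) + norm (\<Sum>j<n. g j *\<^sub>R y j)"
          by (simp only: norm_triangle_ineq4)
        moreover have "norm (\<Sum>j<n. g j *\<^sub>R y j) \<le> M * norm f"
          by (rule bd) (use norm_bounded[of f] in \<open>auto simp: g_def\<close>)
        moreover have "2 * \<delta> * \<bar>apply_bcontfun f k\<bar> \<le> 2 * norm (y k) * \<bar>apply_bcontfun f k\<bar>"
          using \<delta> by (intro mult_right_mono) auto
        ultimately show ?thesis by (simp add: abs_mult mult_ac)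
      qed
      moreover have "(\<lambda>n. norm (?S n) + M * norm f) \<longlonglongrightarrow> norm (T f) + M * norm f"
        by (intro tendsto_intros lim[OF f])
      ultimately show ?thesis
        by (intro LIMSEQ_le_const[where X = "\<lambda>n. norm (?S n) + M * norm f"]) (auto intro!: exI[of _ "Suc k"])
    qed
    have "\<delta> > 0" using \<open>M \<ge> 0\<close> assms(3) by linarith
    have "norm f \<le> (norm (T f) + M * norm f) / (2 * \<delta>)"
      by (rule norm_bound) (use k_le \<open>\<delta> > 0\<close> in \<open>simp add: field_simps\<close>)
    then show ?thesis using \<open>\<delta> > 0\<close> by (simp add: field_simps)
  qed
  have add: "T (f + g) = T f + T g" if "f \<in> c0" "g \<in> c0" for f g
    using suminf_add[OF sm sm] that
    by (simp add: T_def c0_def plus_bcontfun.rep_eq scaleR_add_left)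
  have scale: "T (r *\<^sub>R f) = r *\<^sub>R T f" if "f \<in> c0" for r f
    using suminf_scaleR_right[OF sm, of "apply_bcontfun f" r] that
    by (simp add: T_def c0_def scaleR_bcontfun.rep_eq)
  have "norm (T f) \<le> (M + 1) * norm f" if "f \<in> c0" for f
    by (rule order_trans[OF upper[OF that] mult_right_mono]) auto
  with add scale lower assms(3) \<open>M \<ge> 0\<close> show ?thesis
    unfolding contains_isomorph_def
    by (intro exI[of _ T] conjI exI[of _ "2 * \<delta> - M"] exI[of _ "M + 1"]) auto
qed

subsection \<open>Selecting a \<open>c\<^sub>0\<close>-sequence\<close>

text \<open>The norm \<open>N\<close> and the model enter the selection only through these
  assumptions. The 2 in \<open>sum_le\<close> comes from \<open>array_norm_le\<close> with
  \<open>\<eta> = 1\<close> and from \<open>norm x \<le> N x\<close>.\<close>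

context
  fixes x :: "nat \<Rightarrow> nat \<Rightarrow> 'a::real_normed_vector" and L :: real and \<phi> :: "'a \<Rightarrow> real"
  assumes L_pos: "L > 0"
    and norm_lim: "\<And>r. (\<lambda>m. norm (x r m)) \<longlonglongrightarrow> L"
    and phi_lim: "\<And>r y. (\<lambda>m. norm (y + x r m) + norm (y - x r m)) \<longlonglongrightarrow> \<phi> y"
    and sum_le: "\<And>R. \<exists>m. \<forall>i b. strict_mono i \<longrightarrow> m \<le> i 0 \<longrightarrow> (\<forall>j<R. \<bar>b j\<bar> \<le> 1) \<longrightarrow>
        norm (\<Sum>j<R. b j *\<^sub>R x j (i j)) \<le> 2"
    and defect: "\<And>c r s \<eta>. \<lbrakk>r < s; 0 < \<eta>\<rbrakk> \<Longrightarrow> \<exists>k. \<forall>m\<ge>k. \<forall>n\<ge>m + s.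
        norm_at c (x r m + x s n) + norm_at c (x r m - x s n) \<le> 2 * norm_at c (x r m) + \<eta>"
begin

section \<open>Elementary properties of \<open>\<phi>\<close>\<close>

lemma phi_0: "\<phi> 0 = 2 * L"
proof (rule LIMSEQ_unique)
  show "(\<lambda>m. norm (0 + x 0 m) + norm (0 - x 0 m)) \<longlonglongrightarrow> \<phi> 0" by (rule phi_lim)
  show "(\<lambda>m. norm (0 + x 0 m) + norm (0 - x 0 m)) \<longlonglongrightarrow> 2 * L"
    using tendsto_mult_left[OF norm_lim[of 0], of 2] by simp
qed

lemma phi_ge: "2 * norm y \<le> \<phi> y"
proof (rule LIMSEQ_le_const[OF phi_lim[of y 0]], intro exI allI impI)
  fix m
  have "norm ((y + x 0 m) + (y - x 0 m)) \<le> norm (y + x 0 m) + norm (y - x 0 m)"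
    by (rule norm_triangle_ineq)
  then show "2 * norm y \<le> norm (y + x 0 m) + norm (y - x 0 m)"
    by (simp flip: scaleR_2)
qed

lemma phi_Lipschitz: "\<bar>\<phi> u - \<phi> w\<bar> \<le> 2 * norm (u - w)"
proof -
  let ?f = "\<lambda>y m. norm (y + x 0 m) + norm (y - x 0 m)"
  have "(\<lambda>m. \<bar>?f u m - ?f w m\<bar>) \<longlonglongrightarrow> \<bar>\<phi> u - \<phi> w\<bar>"
    by (intro tendsto_rabs tendsto_diff phi_lim)
  moreover have "\<bar>?f u m - ?f w m\<bar> \<le> 2 * norm (u - w)" for m
    using norm_triangle_ineq3[of "u + x 0 m" "w + x 0 m"]
      norm_triangle_ineq3[of "u - x 0 m" "w - x 0 m"] by simp
  ultimately show ?thesis by (intro LIMSEQ_le_const2) auto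
qed

text \<open>A pointwise limit of convex functions is convex. With \<open>phi_Lipschitz\<close> this
  admits \<open>\<phi>\<close> as the function \<open>h\<close> in
  \<open>exists_small_deviation\<close>.\<close>

lemma phi_convex: "convex_on UNIV \<phi>"
proof (rule convex_onI)
  fix t :: real and u w :: 'a
  assume t: "0 < t" "t < 1"
  let ?f = "\<lambda>y m. norm (y + x 0 m) + norm (y - x 0 m)"
  show "\<phi> ((1 - t) *\<^sub>R u + t *\<^sub>R w) \<le> (1 - t) * \<phi> u + t * \<phi> w"
  proof (rule LIMSEQ_le[OF phi_lim[of _ 0]])
    show "(\<lambda>m. (1 - t) * ?f u m + t * ?f w m) \<longlonglongrightarrow> (1 - t) * \<phi> u + t * \<phi> w"
      by (intro tendsto_add tendsto_mult_left phi_lim)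
    have "?f ((1 - t) *\<^sub>R u + t *\<^sub>R w) m \<le> (1 - t) * ?f u m + t * ?f w m" for m
    proof -
      have "norm ((1 - t) *\<^sub>R u + t *\<^sub>R w + z) \<le> (1 - t) * norm (u + z) + t * norm (w + z)" for z
      proof -
        have "(1 - t) *\<^sub>R u + t *\<^sub>R w + z = (1 - t) *\<^sub>R (u + z) + t *\<^sub>R (w + z)"
          by (simp add: algebra_simps)
        then show ?thesis
          using t norm_triangle_ineq[of "(1 - t) *\<^sub>R (u + z)" "t *\<^sub>R (w + z)"] by simp
      qed
      from this[of "x 0 m"] this[of "- x 0 m"] show ?thesis by (simp add: algebra_simps)
    qed
    then show "\<exists>N. \<forall>m\<ge>N. ?f ((1 - t) *\<^sub>R u + t *\<^sub>R w) m \<le> (1 - t) * ?f u m + t * ?f w m"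
      by blast
  qed
qed simp

section \<open>Second differences of \<open>\<phi>\<close> and the inductive choice\<close>

lemma eventually_sum_le:
  assumes "finite J"
  shows "\<forall>\<^sub>F n in sequentially. \<forall>\<theta>. (\<forall>j. \<theta> j \<in> {-1, 1::real}) \<longrightarrow>
    norm (\<Sum>j\<in>J. \<theta> j *\<^sub>R x j (n + j)) \<le> 2"
proof -
  obtain R where R: "J \<subseteq> {..<R}" using assms finite_nat_iff_bounded by blast
  obtain m where m: "\<And>i b. \<lbrakk>strict_mono i; m \<le> i 0; \<forall>j<R. \<bar>b j\<bar> \<le> 1\<rbrakk>
      \<Longrightarrow> norm (\<Sum>j<R. b j *\<^sub>R x j (i j)) \<le> 2"
    using sum_le by blast
  have "norm (\<Sum>j\<in>J. \<theta> j *\<^sub>R x j (n + j)) \<le> 2"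
    if "m \<le> n" "\<forall>j. \<theta> j \<in> {-1, 1::real}" for n \<theta>
  proof -
    have "norm (\<Sum>j<R. (if j \<in> J then \<theta> j else 0) *\<^sub>R x j (n + j)) \<le> 2"
    proof (rule m)
      show "\<forall>j<R. \<bar>if j \<in> J then \<theta> j else 0\<bar> \<le> 1"
      proof (intro allI impI)
        show "\<bar>if j \<in> J then \<theta> j else 0\<bar> \<le> 1" for j using that(2)[rule_format, of j] by auto
      qed
    qed (use that(1) in \<open>auto simp: strict_mono_def\<close>)
    also have "(\<Sum>j<R. (if j \<in> J then \<theta> j else 0) *\<^sub>R x j (n + j)) = (\<Sum>j\<in>J. \<theta> j *\<^sub>R x j (n + j))"
      by (rule sum.mono_neutral_cong_right) (use R in auto)
    finally show ?thesis .
  qed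
  then show ?thesis unfolding eventually_sequentially by blast
qed

text \<open>Let \<open>u = x r m\<close> and let \<open>v\<close> lie far out in a later row. Then
  \<open>\<phi> (y + u)\<close> and \<open>\<phi> (y - u)\<close> are nearly pairs of norms in the
  direction \<open>v\<close>, and their four terms regroup into pairs around \<open>y\<close> in the
  directions \<open>u + v\<close> and \<open>u - v\<close>. If these directions have norm near
  \<open>L\<close>, the pairs are nearly values of \<open>norm_at c\<close> with
  \<open>y = L *\<^sub>R c\<close>, and \<open>defect\<close> applies.\<close>

lemma phi_second_difference:
  assumes "\<eta> > 0"
  shows "\<forall>\<^sub>F m in sequentially. \<phi> (y + x r m) + \<phi> (y - x r m) \<le> 2 * \<phi> y + \<eta>"
proof -
  define c where "c = (1 / L) *\<^sub>R y"
  have y: "y = L *\<^sub>R c" using L_pos by (simp add: c_def)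
  define \<kappa> where "\<kappa> = norm c"
  have \<kappa>: "\<kappa> \<ge> 0" by (simp add: \<kappa>_def)
  \<comment> \<open>The total error will be
    \<open>(5 + 16 * \<kappa>) * \<delta> + 8 * \<kappa> / K\<close>; \<open>\<delta>\<close> and
    \<open>K\<close> each take half of \<open>\<eta>\<close>.\<close>
  define \<delta> where "\<delta> = \<eta> / (2 * (5 + 16 * \<kappa>))"
  have \<delta>: "\<delta> > 0" "(5 + 16 * \<kappa>) * \<delta> = \<eta> / 2"
    using \<kappa> assms by (auto simp: \<delta>_def field_simps add_pos_nonneg)
  obtain K :: nat where "K > 16 * \<kappa> / \<eta>" using reals_Archimedean2 by blast
  then have K: "K > 0" "8 * \<kappa> / K \<le> \<eta> / 2"
  proof -
    have "0 \<le> 16 * \<kappa> / \<eta>" using \<kappa> assms by simp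
    with \<open>K > 16 * \<kappa> / \<eta>\<close> show "K > 0" by (metis of_nat_0_less_iff order_le_less_trans)
    with \<open>K > 16 * \<kappa> / \<eta>\<close> show "8 * \<kappa> / K \<le> \<eta> / 2" using assms by (simp add: field_simps)
  qed
  define J where "J = {r<..r + K}"
  have J: "finite J" "J \<noteq> {}" "card J = K" using K by (auto simp: J_def)
  have lim_norm_at: "(\<lambda>m. norm_at c (x r m)) \<longlonglongrightarrow> \<phi> y"
  proof -
    from tendsto_add[OF norm_at_diff_tendsto_0[OF norm_lim[of r], of c] phi_lim[of y r]]
    show ?thesis by (simp add: y)
  qed
  have ev_defect: "\<forall>\<^sub>F m in sequentially. \<forall>s\<in>J. \<forall>n\<ge>m + s.
      norm_at b (x r m + x s n) + norm_at b (x r m - x s n) \<le> 2 * norm_at b (x r m) + \<delta>" for b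
    using defect[OF _ \<delta>(1)] J(1)
    by (intro eventually_ball_finite) (auto simp: eventually_sequentially J_def)
  have "\<forall>\<^sub>F m in sequentially. \<bar>norm (x r m) - L\<bar> < \<delta>"
    using tendstoD[OF norm_lim \<delta>(1)] by (simp add: dist_real_def)
  moreover have "\<forall>\<^sub>F m in sequentially. norm_at c (x r m) < \<phi> y + \<delta>"
    using \<delta>(1) by (intro order_tendstoD(2)[OF lim_norm_at]) simp
  \<comment> \<open>The case 0, where \<open>norm_at 0\<close> is twice the norm, provides the
    second-difference hypothesis for averaging the norm itself.\<close>
  moreover note ev_defect[of c] ev_defect[of 0]
  ultimately show ?thesis
  proof eventually_elim
    case (elim m)
    let ?u = "x r m" and ?v = "\<lambda>n s. x s (n + s)"
    have ev_phi: "\<forall>\<^sub>F n in sequentially. \<forall>s\<in>J. \<phi> w - \<delta> < norm (w + ?v n s) + norm (w - ?v n s)" for w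
      using \<delta>(1) J(1)
      by (intro eventually_ball_finite ballI order_tendstoD(1)[OF LIMSEQ_ignore_initial_segment[OF phi_lim]]) auto
    obtain n where n: "m \<le> n"
      "\<And>s. s \<in> J \<Longrightarrow> \<phi> (y + ?u) - \<delta> < norm (y + ?u + ?v n s) + norm (y + ?u - ?v n s)"
      "\<And>s. s \<in> J \<Longrightarrow> \<phi> (y - ?u) - \<delta> < norm (y - ?u + ?v n s) + norm (y - ?u - ?v n s)"
      "\<And>\<theta>. (\<And>s. \<theta> s \<in> {-1, 1::real}) \<Longrightarrow> norm (\<Sum>s\<in>J. \<theta> s *\<^sub>R ?v n s) \<le> 2"
      using eventually_happens'[OF sequentially_bot eventually_conj[OF eventually_ge_at_top[of m]
          eventually_conj[OF ev_phi[of "y + ?u"] eventually_conj[OF ev_phi[of "y - ?u"]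
          eventually_sum_le[OF J(1)]]]]] by blast
    \<comment> \<open>\<open>defect\<close> bounds only the sum of \<open>norm (u + v)\<close> and
      \<open>norm (u - v)\<close>. Averaging over the rows in \<open>J\<close> finds a row where
      each of them is bounded separately.\<close>
    have "\<exists>s\<in>J. \<forall>w\<in>{?u}. max (norm (w + ?v n s)) (norm (w - ?v n s))
        \<le> norm w + card {?u} * (\<delta> + 1 * 2 / card J)"
    proof (rule exists_small_deviation)
      show "convex_on UNIV (norm :: 'a \<Rightarrow> real)" using convex_on_dist[OF convex_UNIV, of "0 :: 'a"] by simp
      show "\<bar>norm w - norm w'\<bar> \<le> 1 * norm (w - w')" for w w' :: 'a
        using norm_triangle_ineq3[of w w'] by simp
      show "norm (w + ?v n s) + norm (w - ?v n s) \<le> 2 * norm w + \<delta>" if "s \<in> J" "w \<in> {?u}" for s w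
      proof -
        have "2 * norm (?u + ?v n s) + 2 * norm (?u - ?v n s) \<le> 4 * norm ?u + \<delta>"
          using elim(4) that(1) n(1) by (force simp: norm_at_0)
        then show ?thesis using that(2) \<delta>(1) norm_ge_zero[of ?u] by simp
      qed
    qed (use J n(4) in auto)
    then obtain s where s: "s \<in> J" and
      le: "norm (?u + ?v n s) \<le> norm ?u + (\<delta> + 2 / K)" "norm (?u - ?v n s) \<le> norm ?u + (\<delta> + 2 / K)"
      using J(3) by auto
    let ?v = "?v n s"
    have "norm ((?u + ?v) + (?u - ?v)) \<le> norm (?u + ?v) + norm (?u - ?v)"
      by (rule norm_triangle_ineq)
    then have "2 * norm ?u \<le> norm (?u + ?v) + norm (?u - ?v)"
      by (simp flip: scaleR_2)
    \<comment> \<open>Each upper bound implies a lower bound for the other norm, since the two add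
      up to at least \<open>2 * norm ?u\<close>.\<close>
    then have near: "\<bar>norm (?u + ?v) - L\<bar> \<le> 4 * \<delta> + 2 / K" "\<bar>norm (?u - ?v) - L\<bar> \<le> 4 * \<delta> + 2 / K"
      using le elim(1) \<delta>(1) by linarith+
    have shift: "norm (y + w) + norm (y - w) \<le> norm_at c w + 2 * ((4 * \<delta> + 2 / K) * \<kappa>)"
      if "\<bar>norm w - L\<bar> \<le> 4 * \<delta> + 2 / K" for w
    proof -
      have "norm (norm w *\<^sub>R c - L *\<^sub>R c) \<le> (4 * \<delta> + 2 / K) * \<kappa>"
        using mult_right_mono[OF that \<kappa>] by (simp add: \<kappa>_def flip: scaleR_diff_left)
      then show ?thesis using norm_at_diff_scaled[of c w L c] unfolding y by linarith
    qed
    have "\<phi> (y + ?u) + \<phi> (y - ?u) - 2 * \<delta>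
        \<le> (norm (y + ?u + ?v) + norm (y + ?u - ?v)) + (norm (y - ?u + ?v) + norm (y - ?u - ?v))"
      using n(2,3)[OF s] by linarith
    also have "\<dots> = (norm (y + (?u + ?v)) + norm (y - (?u + ?v))) + (norm (y + (?u - ?v)) + norm (y - (?u - ?v)))"
      by (simp add: algebra_simps)
    also have "\<dots> \<le> norm_at c (?u + ?v) + norm_at c (?u - ?v) + 4 * ((4 * \<delta> + 2 / K) * \<kappa>)"
      using shift[OF near(1)] shift[OF near(2)] by linarith
    also have "norm_at c (?u + ?v) + norm_at c (?u - ?v) \<le> 2 * norm_at c ?u + \<delta>"
      using elim(3) s n(1) by force
    also have "2 * norm_at c ?u \<le> 2 * \<phi> y + 2 * \<delta>" using elim(2) by simp
    finally have "\<phi> (y + ?u) + \<phi> (y - ?u) \<le> 2 * \<phi> y + ((5 + 16 * \<kappa>) * \<delta> + 8 * \<kappa> / K)"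
      by (simp add: algebra_simps)
    then show ?case using \<delta>(2) K(2) by linarith
  qed
qed

text \<open>The candidates are the entries \<open>x j (n + j)\<close> for \<open>j < K\<close> and
  one large \<open>n\<close>; \<open>exists_small_deviation\<close> for \<open>\<phi>\<close>, with
  Lipschitz constant 2 and signed sums bounded by 2, selects one that suits all of
  \<open>Y\<close>.\<close>

lemma extend_c0_sequence:
  assumes Y: "finite Y" and "\<epsilon> > 0"
  shows "\<exists>z. \<bar>norm z - L\<bar> < \<epsilon> \<and> (\<forall>y\<in>Y. \<phi> (y + z) \<le> \<phi> y + \<epsilon> \<and> \<phi> (y - z) \<le> \<phi> y + \<epsilon>)"
proof -
  \<comment> \<open>The averaging error is at most \<open>card Y * (2 * \<delta>)\<close>, hence at
    most \<open>\<epsilon>\<close>; the \<open>+ 1\<close> covers empty \<open>Y\<close>.\<close>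
  define \<delta> where "\<delta> = \<epsilon> / (2 * (card Y + 1))"
  have "\<delta> > 0" using \<open>\<epsilon> > 0\<close> by (simp add: \<delta>_def)
  obtain K :: nat where K': "K > 4 / \<delta>" using reals_Archimedean2 by blast
  then have "K > 0" using \<open>\<delta> > 0\<close> by (smt (verit) divide_pos_pos of_nat_0_less_iff)
  then have K: "2 * 2 / K \<le> \<delta>" using K' \<open>\<delta> > 0\<close> by (simp add: field_simps)
  have card_le: "card Y * (\<delta> + 2 * 2 / card {..<K}) \<le> \<epsilon>"
  proof -
    have "card Y * (\<delta> + 2 * 2 / card {..<K}) \<le> card Y * (2 * \<delta>)"
      using K by (intro mult_left_mono) auto
    also have "\<dots> \<le> \<epsilon>" using \<open>\<epsilon> > 0\<close> by (simp add: \<delta>_def field_simps)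
    finally show ?thesis .
  qed
  let ?v = "\<lambda>n j. x j (n + j)"
  have "\<forall>\<^sub>F n in sequentially. \<forall>j\<in>{..<K}. \<bar>norm (?v n j) - L\<bar> < \<epsilon>"
    using tendstoD[OF LIMSEQ_ignore_initial_segment[OF norm_lim] \<open>\<epsilon> > 0\<close>]
    by (intro eventually_ball_finite) (auto simp: dist_real_def)
  moreover have "\<forall>\<^sub>F n in sequentially. \<forall>j\<in>{..<K}. \<forall>y\<in>Y.
      \<phi> (y + ?v n j) + \<phi> (y - ?v n j) \<le> 2 * \<phi> y + \<delta>"
    using phi_second_difference[OF \<open>\<delta> > 0\<close>] Y
    by (intro eventually_ball_finite ballI sequentially_offset) auto
  moreover have "\<forall>\<^sub>F n in sequentially. \<forall>\<theta>. (\<forall>j. \<theta> j \<in> {-1, 1::real}) \<longrightarrow>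
      norm (\<Sum>j<K. \<theta> j *\<^sub>R ?v n j) \<le> 2"
    by (rule eventually_sum_le) simp
  ultimately have "\<forall>\<^sub>F n in sequentially. (\<forall>j\<in>{..<K}. \<bar>norm (?v n j) - L\<bar> < \<epsilon>) \<and>
      (\<forall>j\<in>{..<K}. \<forall>y\<in>Y. \<phi> (y + ?v n j) + \<phi> (y - ?v n j) \<le> 2 * \<phi> y + \<delta>) \<and>
      (\<forall>\<theta>. (\<forall>j. \<theta> j \<in> {-1, 1::real}) \<longrightarrow> norm (\<Sum>j<K. \<theta> j *\<^sub>R ?v n j) \<le> 2)"
    by (intro eventually_conj)
  from eventually_happens'[OF sequentially_bot this] obtain n where
    n: "\<And>j. j \<in> {..<K} \<Longrightarrow> \<bar>norm (?v n j) - L\<bar> < \<epsilon>"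
    "\<And>j y. \<lbrakk>j \<in> {..<K}; y \<in> Y\<rbrakk> \<Longrightarrow> \<phi> (y + ?v n j) + \<phi> (y - ?v n j) \<le> 2 * \<phi> y + \<delta>"
    "\<And>\<theta>. (\<And>j. \<theta> j \<in> {-1, 1::real}) \<Longrightarrow> norm (\<Sum>j<K. \<theta> j *\<^sub>R ?v n j) \<le> 2"
    by blast
  have "{..<K} \<noteq> {}" using \<open>K > 0\<close> by blast
  then obtain j where "j \<in> {..<K}" "\<forall>y\<in>Y. max (\<phi> (y + ?v n j)) (\<phi> (y - ?v n j))
      \<le> \<phi> y + card Y * (\<delta> + 2 * 2 / card {..<K})"
    using exists_small_deviation[OF phi_convex phi_Lipschitz finite_lessThan _ Y n(3) n(2)] by auto
  then show ?thesis using n(1)[of j] card_le by (intro exI[of _ "?v n j"]) force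
qed

lemma exists_c0_sequence:
  assumes "\<epsilon> > 0"
  obtains z :: "nat \<Rightarrow> 'a" where "\<And>k. \<bar>norm (z k) - L\<bar> < \<epsilon>"
    "\<And>n \<theta>. (\<And>k. \<theta> k \<in> {-1, 1::real}) \<Longrightarrow> norm (\<Sum>k<n. \<theta> k *\<^sub>R z k) \<le> L + \<epsilon>"
proof -
  \<comment> \<open>A state pairs a finite set, meant to contain all signed sums of the first
    \<open>n\<close> vectors, with the vector chosen last. The permitted excess of
    \<open>\<phi>\<close> is the sum of the increments \<open>\<epsilon> * (1/2) ^ k\<close> over
    \<open>k < n\<close>.\<close>
  define P where "P n p \<longleftrightarrow> finite (fst p) \<and> (n = 0 \<longrightarrow> 0 \<in> fst p) \<and>
      (\<forall>y\<in>fst p. \<phi> y \<le> 2 * L + 2 * \<epsilon> * (1 - (1/2) ^ n))" for n and p :: "'a set \<times> 'a"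
  define Q where "Q n p q \<longleftrightarrow> \<bar>norm (snd q) - L\<bar> < \<epsilon> \<and>
      (\<forall>y\<in>fst p. y + snd q \<in> fst q \<and> y - snd q \<in> fst q)"
    for n :: nat and p q :: "'a set \<times> 'a"
  have "\<exists>f. \<forall>n. P n (f n) \<and> Q n (f n) (f (Suc n))"
  proof (rule dependent_nat_choice)
    have "P 0 ({0}, 0)" by (simp add: P_def phi_0)
    then show "\<exists>p. P 0 p" by blast
  next
    fix p n assume "P n p"
    then have fin: "finite (fst p)"
      and le: "\<And>y. y \<in> fst p \<Longrightarrow> \<phi> y \<le> 2 * L + 2 * \<epsilon> * (1 - (1/2) ^ n)"
      by (auto simp: P_def)
    define \<eta> where "\<eta> = \<epsilon> * (1/2) ^ n"
    have "\<eta> > 0" using assms by (simp add: \<eta>_def)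
    from extend_c0_sequence[OF fin this] obtain z where z: "\<bar>norm z - L\<bar> < \<eta>"
      "\<And>y. y \<in> fst p \<Longrightarrow> \<phi> (y + z) \<le> \<phi> y + \<eta> \<and> \<phi> (y - z) \<le> \<phi> y + \<eta>" by blast
    have "\<eta> \<le> \<epsilon>" using assms by (simp add: \<eta>_def power_le_one mult_left_le)
    have step: "2 * L + 2 * \<epsilon> * (1 - (1/2) ^ n) + \<eta> = 2 * L + 2 * \<epsilon> * (1 - (1/2) ^ Suc n)"
      by (simp add: \<eta>_def algebra_simps)
    define q where "q = ((\<lambda>y. y + z) ` fst p \<union> (\<lambda>y. y - z) ` fst p, z)"
    have "\<phi> (y + z) \<le> 2 * L + 2 * \<epsilon> * (1 - (1/2) ^ Suc n)"
      "\<phi> (y - z) \<le> 2 * L + 2 * \<epsilon> * (1 - (1/2) ^ Suc n)" if "y \<in> fst p" for y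
      using le[OF that] z(2)[OF that] step by linarith+
    then have "P (Suc n) q" using fin by (auto simp: P_def q_def simp del: power_Suc)
    moreover have "Q n p q" using z(1) \<open>\<eta> \<le> \<epsilon>\<close> by (auto simp: Q_def q_def)
    ultimately show "\<exists>q. P (Suc n) q \<and> Q n p q" by blast
  qed
  then obtain f where f: "\<And>n. P n (f n)" "\<And>n. Q n (f n) (f (Suc n))" by blast
  \<comment> \<open>The vector added in step \<open>k\<close> is stored in state
    \<open>Suc k\<close>; that of state 0 is a dummy.\<close>
  define z where "z k = snd (f (Suc k))" for k
  have bound: "norm (\<Sum>k<n. \<theta> k *\<^sub>R z k) \<le> L + \<epsilon>" if \<theta>: "\<And>k. \<theta> k \<in> {-1, 1::real}" for n \<theta>
  proof -
    have "(\<Sum>k<n. \<theta> k *\<^sub>R z k) \<in> fst (f n)"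
    proof (induction n)
      case (Suc n)
      then show ?case using f(2)[of n] \<theta>[of n] by (auto simp: Q_def z_def)
    qed (use f(1)[of 0] in \<open>simp add: P_def\<close>)
    then have "\<phi> (\<Sum>k<n. \<theta> k *\<^sub>R z k) \<le> 2 * L + 2 * \<epsilon> * (1 - (1/2) ^ n)"
      using f(1)[of n] by (simp add: P_def)
    also have "\<dots> \<le> 2 * L + 2 * \<epsilon>" using assms by simp
    finally show ?thesis using phi_ge[of "\<Sum>k<n. \<theta> k *\<^sub>R z k"] by linarith
  qed
  show ?thesis
  proof (rule that)
    show "\<bar>norm (z k) - L\<bar> < \<epsilon>" for k using f(2)[of k] by (simp add: Q_def z_def)
  qed (fact bound)
qed

end

theorem theorem4p2:
  fixes N :: "'a::banach \<Rightarrow> real"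
    and x :: "nat \<Rightarrow> nat \<Rightarrow> 'a"
    and e :: "nat \<Rightarrow> 'e::banach"
  assumes "separable_space (euclidean :: 'a topology)"
    and "\<not> (\<exists>B :: 'a set. finite B \<and> span B = UNIV)"
    and "asymptotic_norm N"
    and "basic_array N x"
    and "weakly_null_array x"
    and "asymptotic_model N x e"
    and "equivalent_seqs 1 e c0_unit"
  shows "contains_isomorph TYPE('a) c0"
proof -
  note N = assms(3) and x = assms(4,6,7)
  obtain L \<phi> where "L > 0" and lim: "\<And>r. (\<lambda>m. norm (x r m)) \<longlonglongrightarrow> L"
    "\<And>r y. (\<lambda>m. norm (y + x r m) + norm (y - x r m)) \<longlonglongrightarrow> \<phi> y"
    using norm_pair_array_tendsto[OF N x] by metis
  have sum_le: "\<exists>m. \<forall>i b. strict_mono i \<longrightarrow> m \<le> i 0 \<longrightarrow> (\<forall>j<R. \<bar>b j\<bar> \<le> 1) \<longrightarrow>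
      norm (\<Sum>j<R. b j *\<^sub>R x j (i j)) \<le> 2" for R
  proof -
    obtain m where m: "\<And>i b. \<lbrakk>strict_mono i; m \<le> i 0; \<And>j. j < R \<Longrightarrow> \<bar>b j\<bar> \<le> 1\<rbrakk>
      \<Longrightarrow> N (\<Sum>j<R. b j *\<^sub>R x j (i j)) \<le> 1 + 1"
      using array_norm_le[OF x zero_less_one, of R] by metis
    have "norm (\<Sum>j<R. b j *\<^sub>R x j (i j)) \<le> 2"
      if "strict_mono i" "m \<le> i 0" "\<forall>j<R. \<bar>b j\<bar> \<le> 1" for i b
      using order_trans[OF asymptotic_norm_ge[OF N] m[of i b]] that by simp
    then show ?thesis by blast
  qed
  have defect: "\<exists>k. \<forall>m\<ge>k. \<forall>n\<ge>m + s.
      norm_at c (x r m + x s n) + norm_at c (x r m - x s n) \<le> 2 * norm_at c (x r m) + \<eta>"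
    if rs: "r < s" and \<eta>: "0 < \<eta>" for c r s \<eta>
  proof -
    obtain k where k: "\<And>m n. \<lbrakk>k \<le> m; m + s \<le> n\<rbrakk> \<Longrightarrow>
      norm_at c (x r m + x s n) + norm_at c (x r m - x s n)
        \<le> 2 * min (norm_at c (x r m)) (norm_at c (x s n)) + \<eta>"
      using array_pair_defect[OF N x \<eta> rs] by metis
    have "norm_at c (x r m + x s n) + norm_at c (x r m - x s n) \<le> 2 * norm_at c (x r m) + \<eta>"
      if "k \<le> m" "m + s \<le> n" for m n
      using k[OF that] by linarith
    then show ?thesis by blast
  qed
  \<comment> \<open>With \<open>\<epsilon> = L / 4\<close> the signed sums are bounded by
    \<open>5 / 4 * L\<close>, below twice the lower bound \<open>3 / 4 * L\<close> on the norms, as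
    \<open>contains_c0I\<close> demands.\<close>
  have "L / 4 > 0" using \<open>L > 0\<close> by simp
  from exists_c0_sequence[OF \<open>L > 0\<close> lim sum_le defect this] obtain z :: "nat \<Rightarrow> 'a" where
    z: "\<And>k. \<bar>norm (z k) - L\<bar> < L / 4"
    "\<And>n \<theta>. (\<And>k. \<theta> k \<in> {-1, 1::real}) \<Longrightarrow> norm (\<Sum>k<n. \<theta> k *\<^sub>R z k) \<le> L + L / 4"
    by blast
  show ?thesis
  proof (rule contains_c0I[where y = z and M = "L + L / 4" and \<delta> = "3 / 4 * L"])
    show "3 / 4 * L \<le> norm (z k)" for k using z(1)[of k] by linarith
  qed (use z(2) \<open>L > 0\<close> in auto)
qed

end
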